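(* Let the Pick matrix $P$ of an interpolation data set be invertible, let $\varphi\in\widetilde{\mathbf{N}}_0$, let $w=\mathbf{T}_\Theta[\varphi]$, and let $x_i$ be an interpolation node with $i\in\{\ell+1,\dots,n\}$. Suppose that $\tilde e_i\ne0$. Then: 1. The nontangential boundary limit $w_{-1}(x_i)$ exists and $w_{-1}(x_i)=\xi_i$ if and only if $\varphi$ meets either condition $\mathbf C_1$ or $\mathbf C_2$ at $x_i$. 2. The nontangential boundary limit $w_{-1}(x_i)$ exists and $-\infty<-w_{-1}^{-1}(x_i)<-\xi_i^{-1}$ if and only if $\varphi$ meets condition $\mathbf C_3$ at $x_i$. 3. The nontangential boundary limit $w_{-1}(x_i)$ exists and $-\xi_i^{-1}<-w_{-1}^{-1}(x_i)<\infty$ if and only if $\varphi$ meets condition $\mathbf C_4$ at $x_i$. 4. The nontangential boundary limit $w_{-1}(x_i)$ exists and $w_{-1}(x_i)=0$ if and only if $\varphi$ meets either condition $\mathbf C_5$ or $\mathbf C_6$ at $x_i$.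
   Context: Classes. $\mathbb{C}^+$ is the open upper half plane. For $f$ meromorphic on $\mathbb{C}^+$, $K_f(z,\zeta)=\frac{f(z)-\overline{f(\zeta)}}{z-\bar\zeta}$. $\mathbf{N}_0$ is the Nevanlinna class (functions analytic on $\mathbb{C}^+$ with nonnegative imaginary part) and $\widetilde{\mathbf{N}}_0=\mathbf{N}_0\cup\{\infty\}$, where $\infty$ is the function identically $\infty$. Boundary limits. For $x\in\mathbb{R}$, $f(x)$, $f'(x)$, $f_{-1}(x)$ and $K_f(x,x)$ denote the nontangential limits as $z\to x$ of $f(z)$, $f'(z)$, $(z-x)f(z)$ and $K_f(z,z)$, when they exist (values $\infty$ allowed for $f(x)$, $f_{-1}(x)$, $K_f(x,x)$). If $f\equiv\infty$, then $f_{-1}(x)=\infty$. Here $f_{-1}^{-1}(x)=1/f_{-1}(x)$, with $1/\infty=0$ (while $1/0$ is not finite). Data. $x_1,\dots,x_n$ are distinct real numbers (nodes), $0\le\ell\le n$, $w_j,\gamma_j\in\mathbb{R}$ $(1\le j\le\ell)$, $\xi_k\in\mathbb{R}\setminus\{0\}$ $(\ell<k\le n)$. The Pick matrix $P=[p_{ij}]_{i,j=1}^n$ is the real symmetric matrix with: $p_{ij}=\frac{w_j-w_i}{x_j-x_i}$ for $i\ne j$ and $p_{ii}=\gamma_i$, for $i,j\le\ell$; $p_{ij}=p_{ji}=\frac{\xi_j}{x_j-x_i}$ for $i\le\ell<j$; $p_{ii}=-\xi_i$ and $p_{ij}=0$ $(i\neq j)$ for $i,j>\ell$. Also $X=\mathrm{diag}(x_1,\dots,x_n)$,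 $C=[w_1\ \cdots\ w_\ell\ \xi_{\ell+1}\ \cdots\ \xi_n]$, $E=[1\ \cdots\ 1\ 0\ \cdots\ 0]$ ($\ell$ ones), $J=\begin{bmatrix}0&-i\\ i&0\end{bmatrix}$. For $P$ invertible, $\Theta(z)=[\Theta_{ij}(z)]_{i,j=1}^2=I_2-i\begin{bmatrix}C\\ E\end{bmatrix}(zI-X)^{-1}P^{-1}\begin{bmatrix}C^*&E^*\end{bmatrix}J$ and $\mathbf{T}_\Theta[\varphi]=\frac{\Theta_{11}\varphi+\Theta_{12}}{\Theta_{21}\varphi+\Theta_{22}}$, with $\mathbf{T}_\Theta[\infty]=\Theta_{11}/\Theta_{21}$ ($\mathbf{T}_\Theta[\varphi]\equiv\infty$ if the denominator vanishes identically). Let $\tilde c_i$, $\tilde e_i$ be the $i$-th entries of the row vectors $CP^{-1}$, $EP^{-1}$ (real), $\eta_i=\tilde c_i/\tilde e_i$, and $\tilde p_{ii}$ the $i$-th diagonal entry of $P^{-1}$. Conditions on $\varphi\in\widetilde{\mathbf{N}}_0$ at $x_i$ when $\tilde e_i\ne0$ (exactly one holds): $\mathbf C_1$: the limit $\varphi(x_i)$ does not exist, or exists and is not equal to $\eta_i$. $\mathbf C_2$: $\varphi(x_i)=\eta_i$ and $K_\varphi(x_i,x_i)=\infty$. $\mathbf C_3$: $\varphi(x_i)=\eta_i$ and $-\tilde p_{ii}/\tilde e_i^2<\varphi'(x_i)<\infty$. $\mathbf C_4$: $\varphi(x_i)=\eta_i$ and $0\le\varphi'(x_i)<-\tilde p_{ii}/\tilde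 e_i^2$. $\mathbf C_5$: $\varphi(x_i)=\eta_i$ and $\varphi'(x_i)=-\tilde p_{ii}/\tilde e_i^2>0$. $\mathbf C_6$: $\varphi(x_i)=\eta_i$ and $\varphi'(x_i)=\tilde p_{ii}=0$. *)

theory Defs
  imports
    "HOL-Analysis.Analysis"
    "Jordan_Normal_Form.Gauss_Jordan_Elimination"
begin

datatype ecomplex = Fin (fin_part: complex) | EInf

text \<open>\<open>escale c u\<close> is the product \<open>c u\<close>; it is only used for \<open>c \<noteq> 0\<close>.\<close>

fun escale :: "complex \<Rightarrow> ecomplex \<Rightarrow> ecomplex" where
  "escale c (Fin u) = Fin (c * u)"
| "escale c EInf = EInf"

fun einverse :: "ecomplex \<Rightarrow> ecomplex" where
  "einverse (Fin u) = (if u = 0 then EInf else Fin (1 / u))"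
| "einverse EInf = Fin 0"

fun ediv :: "complex \<Rightarrow> complex \<Rightarrow> ecomplex" where
  "ediv a b = (if b = 0 then EInf else Fin (a / b))"

definition upper_half_plane :: "complex set" where
  "upper_half_plane = {z. 0 < Im z}"

definition stolz_angle :: "real \<Rightarrow> real \<Rightarrow> complex set" where
  "stolz_angle x a = {z. 0 < Im z \<and> \<bar>Re z - x\<bar> < a * Im z}"

text \<open>Something holds eventually for this filter iff it does so as \<open>z \<rightarrow> x\<close> within
  each angle \<open>stolz_angle x a\<close> separately.\<close>

definition nontangentially :: "real \<Rightarrow> complex filter" where
  "nontangentially x = (SUP a\<in>{0<..}. at (complex_of_real x) within stolz_angle x a)"

fun etendsto :: "(complex \<Rightarrow> ecomplex) \<Rightarrow> ecomplex \<Rightarrow> complex filter \<Rightarrow> bool" where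
  "etendsto g (Fin c) F \<longleftrightarrow>
     (\<forall>\<epsilon>>0. \<forall>\<^sub>F z in F. \<exists>u. g z = Fin u \<and> dist u c < \<epsilon>)"
| "etendsto g EInf F \<longleftrightarrow>
     (\<forall>R. \<forall>\<^sub>F z in F. \<forall>u. g z = Fin u \<longrightarrow> R < norm u)"

abbreviation nt_limit :: "(complex \<Rightarrow> ecomplex) \<Rightarrow> real \<Rightarrow> ecomplex \<Rightarrow> bool" where
  "nt_limit g x L \<equiv> etendsto g L (nontangentially x)"

text \<open>\<open>residual_limit w x L\<close> says that the limit \<open>w\<^sub>-\<^sub>1(x)\<close> exists and equals \<open>L\<close>.\<close>

definition residual_limit :: "(complex \<Rightarrow> ecomplex) \<Rightarrow> real \<Rightarrow> ecomplex \<Rightarrow> bool" where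
  "residual_limit w x L \<longleftrightarrow> nt_limit (\<lambda>z. escale (z - complex_of_real x) (w z)) x L"

definition nevanlinna :: "(complex \<Rightarrow> complex) set" where
  "nevanlinna = {f. f holomorphic_on upper_half_plane \<and> (\<forall>z\<in>upper_half_plane. 0 \<le> Im (f z))}"

definition ext_nevanlinna :: "(complex \<Rightarrow> ecomplex) set" where
  "ext_nevanlinna =
     {\<phi>. (\<exists>f\<in>nevanlinna. \<forall>z\<in>upper_half_plane. \<phi> z = Fin (f z)) \<or>
         (\<forall>z\<in>upper_half_plane. \<phi> z = EInf)}"

definition nev_kernel :: "(complex \<Rightarrow> complex) \<Rightarrow> complex \<Rightarrow> complex \<Rightarrow> complex" where
  "nev_kernel f z \<zeta> = (f z - cnj (f \<zeta>)) / (z - cnj \<zeta>)"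

text \<open>All indices start at \<open>0\<close>: the nodes are \<open>x\<^sub>0, \<dots>, x\<^sub>n\<^sub>-\<^sub>1\<close>, and the first \<open>\<ell>\<close> of them,
  those with index less than \<open>\<ell>\<close>, carry \<open>w\<^sub>j\<close> (\<open>target\<close>) and \<open>\<gamma>\<^sub>j\<close> (\<open>gam\<close>),
  the others \<open>\<xi>\<^sub>j\<close>.
  The functions are irrelevant outside the corresponding index ranges.\<close>

record interp_data =
  num_nodes :: nat
  num_regular :: nat
  node :: "nat \<Rightarrow> real"
  target :: "nat \<Rightarrow> real"
  gam :: "nat \<Rightarrow> real"
  xi :: "nat \<Rightarrow> real"

definition valid_data :: "interp_data \<Rightarrow> bool" where
  "valid_data D \<longleftrightarrow>
     num_regular D \<le> num_nodes D \<and>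
     inj_on (node D) {..<num_nodes D} \<and>
     (\<forall>k\<in>{num_regular D..<num_nodes D}. xi D k \<noteq> 0)"

definition pick_entry :: "interp_data \<Rightarrow> nat \<Rightarrow> nat \<Rightarrow> real" where
  "pick_entry D i j =
     (if i < num_regular D \<and> j < num_regular D then
        (if i = j then gam D i else (target D j - target D i) / (node D j - node D i))
      else if i < num_regular D then xi D j / (node D j - node D i)
      else if j < num_regular D then xi D i / (node D i - node D j)
      else if i = j then - xi D i else 0)"

definition pick_matrix :: "interp_data \<Rightarrow> real mat" where
  "pick_matrix D = Matrix.mat (num_nodes D) (num_nodes D) (\<lambda>(i, j). pick_entry D i j)"

text \<open>Row vectors are matrices with one row.\<close>

definition C_row :: "interp_data \<Rightarrow> real mat" where
  "C_row D = Matrix.mat 1 (num_nodes D)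
     (\<lambda>(_, j). if j < num_regular D then target D j else xi D j)"

definition E_row :: "interp_data \<Rightarrow> real mat" where
  "E_row D = Matrix.mat 1 (num_nodes D) (\<lambda>(_, j). if j < num_regular D then 1 else 0)"

text \<open>The library's inverse is \<open>None\<close> for a singular matrix; \<open>minv\<close> is only meaningful
  for invertible ones.\<close>

definition minv :: "'a::field mat \<Rightarrow> 'a mat" where
  "minv A = the (mat_inverse A)"

definition c_tilde :: "interp_data \<Rightarrow> nat \<Rightarrow> real" where
  "c_tilde D i = (C_row D * minv (pick_matrix D)) $$ (0, i)"

definition e_tilde :: "interp_data \<Rightarrow> nat \<Rightarrow> real" where
  "e_tilde D i = (E_row D * minv (pick_matrix D)) $$ (0, i)"

definition eta :: "interp_data \<Rightarrow> nat \<Rightarrow> real" where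
  "eta D i = c_tilde D i / e_tilde D i"

definition p_tilde :: "interp_data \<Rightarrow> nat \<Rightarrow> real" where
  "p_tilde D i = minv (pick_matrix D) $$ (i, i)"

definition X_mat :: "interp_data \<Rightarrow> complex mat" where
  "X_mat D = mat_diag (num_nodes D) (\<lambda>j. complex_of_real (node D j))"

definition J_mat :: "complex mat" where
  "J_mat = mat_of_rows_list 2 [[0, - \<i>], [\<i>, 0]]"

text \<open>As \<open>C\<close> and \<open>E\<close> are real, \<open>[C\<^sup>* E\<^sup>*]\<close> is the transpose of the stacked matrix.\<close>

definition CE_mat :: "interp_data \<Rightarrow> complex mat" where
  "CE_mat D = map_mat complex_of_real (C_row D @\<^sub>r E_row D)"

definition Theta :: "interp_data \<Rightarrow> complex \<Rightarrow> complex mat" where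
  "Theta D z =
     1\<^sub>m 2 - \<i> \<cdot>\<^sub>m (CE_mat D * minv (z \<cdot>\<^sub>m 1\<^sub>m (num_nodes D) - X_mat D)
       * map_mat complex_of_real (minv (pick_matrix D)) * transpose_mat (CE_mat D) * J_mat)"

text \<open>\<open>T\<^sub>\<Theta>[\<phi>]\<close>, including the value \<open>\<infinity>\<close> at the zeros of the denominator. The matrix
  \<open>\<Theta>(z)\<close> is nonsingular away from the nodes, so numerator and denominator have no common zero
  in the upper half plane; if the denominator vanishes identically there, all values are \<open>\<infinity>\<close>.\<close>

definition T_Theta :: "interp_data \<Rightarrow> (complex \<Rightarrow> ecomplex) \<Rightarrow> complex \<Rightarrow> ecomplex" where
  "T_Theta D \<phi> z =
     (case \<phi> z of
        Fin u \<Rightarrow> ediv (Theta D z $$ (0, 0) * u + Theta D z $$ (0, 1))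
                     (Theta D z $$ (1, 0) * u + Theta D z $$ (1, 1))
      | EInf \<Rightarrow> ediv (Theta D z $$ (0, 0)) (Theta D z $$ (1, 0)))"

text \<open>The conditions on \<open>K\<^sub>\<phi>\<close> and \<open>\<phi>'\<close> come together with the finite limit \<open>\<eta>\<^sub>i\<close> of \<open>\<phi>\<close>, so
  that for \<open>\<phi>\<close> in \<open>ext_nevanlinna\<close> they are only considered when \<open>\<phi>\<close> has finite values.\<close>

definition value_eta :: "interp_data \<Rightarrow> (complex \<Rightarrow> ecomplex) \<Rightarrow> nat \<Rightarrow> bool" where
  "value_eta D \<phi> i \<longleftrightarrow> nt_limit \<phi> (node D i) (Fin (complex_of_real (eta D i)))"

definition kernel_limit :: "(complex \<Rightarrow> ecomplex) \<Rightarrow> real \<Rightarrow> ecomplex \<Rightarrow> bool" where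
  "kernel_limit \<phi> x L \<longleftrightarrow> nt_limit (\<lambda>z. Fin (nev_kernel (\<lambda>\<zeta>. fin_part (\<phi> \<zeta>)) z z)) x L"

definition deriv_limit :: "(complex \<Rightarrow> ecomplex) \<Rightarrow> real \<Rightarrow> complex \<Rightarrow> bool" where
  "deriv_limit \<phi> x d \<longleftrightarrow> nt_limit (\<lambda>z. Fin (deriv (\<lambda>\<zeta>. fin_part (\<phi> \<zeta>)) z)) x (Fin d)"

definition cond_C1 :: "interp_data \<Rightarrow> (complex \<Rightarrow> ecomplex) \<Rightarrow> nat \<Rightarrow> bool" where
  "cond_C1 D \<phi> i \<longleftrightarrow>
     \<not> (\<exists>L. nt_limit \<phi> (node D i) L) \<or>
     (\<exists>L. nt_limit \<phi> (node D i) L \<and> L \<noteq> Fin (complex_of_real (eta D i)))"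

definition cond_C2 :: "interp_data \<Rightarrow> (complex \<Rightarrow> ecomplex) \<Rightarrow> nat \<Rightarrow> bool" where
  "cond_C2 D \<phi> i \<longleftrightarrow> value_eta D \<phi> i \<and> kernel_limit \<phi> (node D i) EInf"

definition cond_C3 :: "interp_data \<Rightarrow> (complex \<Rightarrow> ecomplex) \<Rightarrow> nat \<Rightarrow> bool" where
  "cond_C3 D \<phi> i \<longleftrightarrow> value_eta D \<phi> i \<and>
     (\<exists>d::real. deriv_limit \<phi> (node D i) (complex_of_real d) \<and>
        - p_tilde D i / (e_tilde D i)\<^sup>2 < d)"

definition cond_C4 :: "interp_data \<Rightarrow> (complex \<Rightarrow> ecomplex) \<Rightarrow> nat \<Rightarrow> bool" where
  "cond_C4 D \<phi> i \<longleftrightarrow> value_eta D \<phi> i \<and>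
     (\<exists>d::real. deriv_limit \<phi> (node D i) (complex_of_real d) \<and>
        0 \<le> d \<and> d < - p_tilde D i / (e_tilde D i)\<^sup>2)"

definition cond_C5 :: "interp_data \<Rightarrow> (complex \<Rightarrow> ecomplex) \<Rightarrow> nat \<Rightarrow> bool" where
  "cond_C5 D \<phi> i \<longleftrightarrow> value_eta D \<phi> i \<and>
     (\<exists>d::real. deriv_limit \<phi> (node D i) (complex_of_real d) \<and>
        d = - p_tilde D i / (e_tilde D i)\<^sup>2 \<and> 0 < d)"

definition cond_C6 :: "interp_data \<Rightarrow> (complex \<Rightarrow> ecomplex) \<Rightarrow> nat \<Rightarrow> bool" where
  "cond_C6 D \<phi> i \<longleftrightarrow> value_eta D \<phi> i \<and> deriv_limit \<phi> (node D i) 0 \<and> p_tilde D i = 0"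

end

theory Submission
  imports Defs "HOL-Complex_Analysis.Conformal_Mappings"
begin

text \<open>
  Let \<open>q(z) = (\<phi>(z) - \<eta>\<^sub>i) / (z - x\<^sub>i)\<close>. The Lyapunov identity for the Pick matrix turns
  \<open>(z - x\<^sub>i) w(z)\<close> into a linear fractional function of \<open>q(z)\<close> whose coefficients converge at
  \<open>x\<^sub>i\<close> to those of the invertible map
  \<open>q \<mapsto> \<xi>\<^sub>i v / (v + 1/\<xi>\<^sub>i)\<close> with \<open>v = e\<^sup>2 q + p\<close>, where \<open>e\<close> and \<open>p\<close> are the numbers
  \<open>e_tilde\<close> and \<open>p_tilde\<close> at \<open>i\<close>. On the other hand, by the
  Julia-Caratheodory theorem \<open>q\<close> always has a nontangential limit \<open>d\<close> in \<open>[0, \<infinity>]\<close>.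
  It is infinite exactly under the first two conditions; if it is finite, then
  \<open>\<phi>(x\<^sub>i) = \<eta>\<^sub>i\<close> and \<open>\<phi>'(x\<^sub>i) = d\<close>, and the sign of \<open>v\<close> at \<open>q = d\<close> separates the remaining
  conditions.
\<close>

section \<open>The Schwarz-Pick inequality on the upper half-plane\<close>

text \<open>At the node \<open>x_i\<close> the first row of \<open>Theta\<close> has a pole, while
  the second row has none because \<open>e_entry D i = 0\<close>. Inserting the parameter value
  \<open>eta D i\<close> removes the pole from the numerator and leaves a factor
  \<open>z - x_i\<close> in the denominator. For a parameter \<open>\<eta> + q (z - x_i)\<close> the
  denominator is thus divisible by \<open>z - x_i\<close>, and this is the factor that the residual
  limit cancels; hence \<open>q\<close>, not the value of the parameter, is the right coordinate.
  The conditions speak of value, kernel and derivative separately, and C1 even allows that the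
  boundary value fails to exist. The classification is exhaustive because \<open>q\<close> converges
  in the extended sense for every Nevanlinna function, also for one without a boundary value. This
  convergence and the blow-up of the kernel both come from the two-point Schwarz-Pick inequality,
  without an integral representation.\<close>

lemma norm_sq_diff_cnj: "(norm (a - cnj b))\<^sup>2 = (norm (a - b))\<^sup>2 + 4 * Im a * Im b"
  unfolding cmod_power2 by (simp add: power2_eq_square algebra_simps)

lemma norm_diff_less_cnj:
  assumes "0 < Im a" "0 < Im b"
  shows "norm (a - b) < norm (a - cnj b)"
proof -
  have "(norm (a - b))\<^sup>2 < (norm (a - cnj b))\<^sup>2"
    using assms by (simp add: norm_sq_diff_cnj)
  then show ?thesis
    by (rule power2_less_imp_less) simp
qed

text \<open>In kernel terms this is
  \<open>|K_f(z,\<zeta>)|^2 \<le> K_f(z,z) K_f(\<zeta>,\<zeta>)\<close> with the denominators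
  multiplied out. Cayley maps centred at \<open>\<zeta>\<close> and at \<open>f \<zeta>\<close>
  reduce it to the Schwarz lemma; strict positivity of \<open>Im f\<close> keeps the transported map
  \<open>g\<close> holomorphic and inside the open disc.\<close>

lemma schwarz_pick_strict:
  assumes hol: "f holomorphic_on upper_half_plane"
    and pos: "\<And>z. 0 < Im z \<Longrightarrow> 0 < Im (f z)"
    and z: "0 < Im z" and \<zeta>: "0 < Im \<zeta>"
  shows "norm (f z - cnj (f \<zeta>)) ^ 2 * (Im z * Im \<zeta>)
    \<le> norm (z - cnj \<zeta>) ^ 2 * (Im (f z) * Im (f \<zeta>))"
proof -
  define \<tau> where "\<tau> = (\<lambda>u. (\<zeta> - cnj \<zeta> * u) / (1 - u))"
  define g where "g = (\<lambda>u. (f (\<tau> u) - f \<zeta>) / (f (\<tau> u) - cnj (f \<zeta>)))"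
  define u where "u = (z - \<zeta>) / (z - cnj \<zeta>)"
  have ne: "a - cnj b \<noteq> 0" if "0 < Im a" "0 < Im b" for a b
    using that by (auto simp: complex_eq_iff)
  have Im\<tau>: "0 < Im (\<tau> v)" if "norm v < 1" for v
  proof -
    have v: "1 - v \<noteq> 0" using that by auto
    have "\<tau> v = (\<zeta> - cnj \<zeta> * v) * cnj (1 - v) / of_real (norm (1 - v) ^ 2)"
      unfolding \<tau>_def by (subst complex_div_cnj) simp
    then have "Im (\<tau> v) = Im ((\<zeta> - cnj \<zeta> * v) * cnj (1 - v)) / norm (1 - v) ^ 2"
      by (metis Im_divide_of_real)
    also have "Im ((\<zeta> - cnj \<zeta> * v) * cnj (1 - v)) = Im \<zeta> * (1 - norm v ^ 2)"
      unfolding cmod_power2 by (simp add: power2_eq_square algebra_simps)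
    finally show ?thesis
      using that \<zeta> v by (simp add: power_less_one_iff abs_square_less_1)
  qed
  have "\<tau> holomorphic_on ball 0 1"
    unfolding \<tau>_def by (intro holomorphic_intros) auto
  moreover have "\<tau> ` ball 0 1 \<subseteq> upper_half_plane"
    using Im\<tau> by (auto simp: upper_half_plane_def)
  ultimately have f\<tau>: "(\<lambda>u. f (\<tau> u)) holomorphic_on ball 0 1"
    using holomorphic_on_compose_gen[of \<tau> "ball 0 1" f upper_half_plane] hol by (auto simp: o_def)
  have "norm (g u) \<le> norm u"
  proof (rule Schwarz_Lemma(1))
    show "g holomorphic_on ball 0 1"
      unfolding g_def using Im\<tau> pos \<zeta> by (intro holomorphic_intros f\<tau> ne) auto
    show "g 0 = 0" by (simp add: g_def \<tau>_def)
    show "norm (g v) < 1" if "norm v < 1" for v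
      using norm_diff_less_cnj[of "f (\<tau> v)" "f \<zeta>"] ne[of "f (\<tau> v)" "f \<zeta>"] pos \<zeta> Im\<tau>[OF that]
      by (simp add: g_def norm_divide)
    show "norm u < 1"
      using norm_diff_less_cnj[OF z \<zeta>] ne[OF z \<zeta>] by (simp add: u_def norm_divide)
  qed
  moreover have "\<tau> u = z"
  proof -
    have "\<zeta> - cnj \<zeta> * u = (\<zeta> - cnj \<zeta>) * z / (z - cnj \<zeta>)" "1 - u = (\<zeta> - cnj \<zeta>) / (z - cnj \<zeta>)"
      unfolding u_def using ne[OF z \<zeta>] by (simp_all add: field_simps)
    then show ?thesis
      using ne[OF z \<zeta>] ne[OF \<zeta> \<zeta>] by (simp add: \<tau>_def)
  qed
  ultimately have "norm (f z - f \<zeta>) * norm (z - cnj \<zeta>) \<le> norm (z - \<zeta>) * norm (f z - cnj (f \<zeta>))"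
    using ne[OF z \<zeta>] ne[of "f z" "f \<zeta>"] pos z \<zeta> by (simp add: g_def u_def norm_divide field_simps)
  \<comment> \<open>After squaring, \<open>norm_sq_diff_cnj\<close> expresses both plain distances
    by the conjugate ones; the product of the two conjugate distances cancels and only the terms
    with imaginary parts remain.\<close>
  then have "(norm (f z - f \<zeta>) * norm (z - cnj \<zeta>))\<^sup>2 \<le> (norm (z - \<zeta>) * norm (f z - cnj (f \<zeta>)))\<^sup>2"
    by (rule power_mono) simp
  then show ?thesis
    using norm_sq_diff_cnj[of "f z" "f \<zeta>"] norm_sq_diff_cnj[of z \<zeta>]
    by (simp add: power_mult_distrib algebra_simps)
qed

text \<open>Adding \<open>\<i> e\<close> makes the imaginary part strictly positive, and both sides
  are continuous in \<open>e\<close>, so the strict case passes to the limit. This brings in the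
  real constants.\<close>

lemma schwarz_pick:
  assumes f: "f \<in> nevanlinna" and z: "0 < Im z" and \<zeta>: "0 < Im \<zeta>"
  shows "norm (f z - cnj (f \<zeta>)) ^ 2 * (Im z * Im \<zeta>)
    \<le> norm (z - cnj \<zeta>) ^ 2 * (Im (f z) * Im (f \<zeta>))"
proof (rule tendsto_le)
  let ?f = "\<lambda>e z. f z + \<i> * complex_of_real e"
  show "((\<lambda>e. norm (z - cnj \<zeta>) ^ 2 * (Im (?f e z) * Im (?f e \<zeta>)))
    \<longlongrightarrow> norm (z - cnj \<zeta>) ^ 2 * (Im (f z) * Im (f \<zeta>))) (at_right 0)"
    by (auto intro!: tendsto_eq_intros)
  show "((\<lambda>e. norm (?f e z - cnj (?f e \<zeta>)) ^ 2 * (Im z * Im \<zeta>))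
    \<longlongrightarrow> norm (f z - cnj (f \<zeta>)) ^ 2 * (Im z * Im \<zeta>)) (at_right 0)"
    by (rule tendsto_eq_intros refl | simp)+
  have "norm (?f e z - cnj (?f e \<zeta>)) ^ 2 * (Im z * Im \<zeta>)
      \<le> norm (z - cnj \<zeta>) ^ 2 * (Im (?f e z) * Im (?f e \<zeta>))" if "0 < e" for e
  proof (rule schwarz_pick_strict[OF _ _ z \<zeta>])
    show "?f e holomorphic_on upper_half_plane"
      using f by (intro holomorphic_intros) (auto simp: nevanlinna_def)
    show "0 < Im (?f e v)" if "0 < Im v" for v
      using f that \<open>0 < e\<close> by (fastforce simp: nevanlinna_def upper_half_plane_def)
  qed
  then show "\<forall>\<^sub>F e in at_right 0. norm (?f e z - cnj (?f e \<zeta>)) ^ 2 * (Im z * Im \<zeta>)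
      \<le> norm (z - cnj \<zeta>) ^ 2 * (Im (?f e z) * Im (?f e \<zeta>))"
    by (auto simp: eventually_at_filter)
qed simp

text \<open>When \<open>f z\<close> is real, the right-hand side of \<open>schwarz_pick\<close> is
  0, so \<open>f \<zeta>\<close> is the conjugate of \<open>f z\<close>, that is, \<open>f z\<close>
  itself.\<close>

lemma nevanlinna_real_value_const:
  assumes f: "f \<in> nevanlinna" and z: "0 < Im z" "Im (f z) = 0" and \<zeta>: "0 < Im \<zeta>"
  shows "f \<zeta> = f z"
  using schwarz_pick[OF f \<zeta> z(1)] z \<zeta>
  by (auto simp: mult_le_0_iff complex_eq_iff)

section \<open>Nontangential limits\<close>

lemma eventually_nontangentially:
  "eventually P (nontangentially x) \<longleftrightarrow>
    (\<forall>a>0. eventually P (at (complex_of_real x) within stolz_angle x a))"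
  unfolding nontangentially_def by (auto simp: eventually_Sup)

lemma eventually_nontangentially_dist:
  "eventually P (nontangentially x) \<longleftrightarrow>
    (\<forall>a>0. \<exists>d>0. \<forall>z\<in>stolz_angle x a. dist z (complex_of_real x) < d \<longrightarrow> P z)"
proof -
  have "z \<noteq> complex_of_real x" if "z \<in> stolz_angle x a" for z a
    using that by (auto simp: stolz_angle_def)
  then show ?thesis
    unfolding eventually_nontangentially eventually_at by (metis (no_types, lifting))
qed

text \<open>Within an angle, \<open>Im z\<close> is comparable to the distance from
  \<open>x\<close>. Every estimate below that trades one for the other uses the constant
  \<open>a + 1\<close>.\<close>

lemma norm_stolz_angle:
  assumes "z \<in> stolz_angle x a"
  shows "norm (z - complex_of_real x) \<le> (a + 1) * Im z"
  using cmod_le[of "z - complex_of_real x"] assms by (auto simp: stolz_angle_def algebra_simps)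

lemma at_within_stolz_angle_neq_bot:
  assumes "0 < a"
  shows "at (complex_of_real x) within stolz_angle x a \<noteq> bot"
proof -
  have "\<exists>z\<in>stolz_angle x a. z \<noteq> complex_of_real x \<and> dist z (complex_of_real x) < d" if "0 < d" for d
    using that assms
    by (intro bexI[of _ "x + \<i> * (d / 2)"])
      (auto simp: stolz_angle_def dist_norm norm_mult complex_eq_iff)
  then show ?thesis
    by (simp add: trivial_limit_within islimpt_approachable)
qed

lemma at_within_stolz_angle_le_nontangentially:
  "0 < a \<Longrightarrow> at (complex_of_real x) within stolz_angle x a \<le> nontangentially x"
  unfolding nontangentially_def by (intro SUP_upper) auto

lemma nontangentially_neq_bot: "nontangentially x \<noteq> bot"
  using at_within_stolz_angle_neq_bot[of 1 x] at_within_stolz_angle_le_nontangentially[of 1 x]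
  by (auto simp: bot_unique)

lemma eventually_Im_pos_nontangentially: "\<forall>\<^sub>F z in nontangentially x. 0 < Im z"
  unfolding eventually_nontangentially_dist by (auto simp: stolz_angle_def intro: exI[of _ 1])

lemma nontangentially_le_at: "nontangentially x \<le> at (complex_of_real x)"
  unfolding nontangentially_def by (intro SUP_least at_le) auto

lemma tendsto_nontangentially_ident:
  "((\<lambda>z. z) \<longlongrightarrow> complex_of_real x) (nontangentially x)"
  using nontangentially_le_at[of x] by (rule tendsto_mono) (rule tendsto_ident_at)

lemma tendsto_nontangentiallyD:
  assumes "(g \<longlongrightarrow> L) (nontangentially x)" "0 < a" "0 < e"
  obtains d where "0 < d"
    "\<And>z. z \<in> stolz_angle x a \<Longrightarrow> dist z (complex_of_real x) < d \<Longrightarrow> dist (g z) L < e"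
  using assms tendstoD[OF assms(1) assms(3)] unfolding eventually_nontangentially_dist by blast

lemma eventually_in_stolz_angle:
  "\<forall>\<^sub>F z in at (complex_of_real x) within stolz_angle x a. z \<in> stolz_angle x a"
  by (simp add: eventually_at_filter)

lemma tendsto_nontangentiallyI:
  assumes "\<And>a. 0 < a \<Longrightarrow> (g \<longlongrightarrow> L) (at (complex_of_real x) within stolz_angle x a)"
  shows "(g \<longlongrightarrow> L) (nontangentially x)"
  using assms unfolding tendsto_def eventually_nontangentially by blast

lemma tendsto_nontangentially_iff:
  "(g \<longlongrightarrow> L) (nontangentially x) \<longleftrightarrow>
    (\<forall>a>0. (g \<longlongrightarrow> L) (at (complex_of_real x) within stolz_angle x a))"
  unfolding tendsto_def eventually_nontangentially by blast

section \<open>Limits of extended-valued functions\<close>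

lemma etendsto_Fin_Fin_iff: "etendsto (\<lambda>z. Fin (g z)) (Fin c) F \<longleftrightarrow> (g \<longlongrightarrow> c) F"
  by (simp add: tendsto_iff)

lemma etendsto_Fin_EInf_iff: "etendsto (\<lambda>z. Fin (g z)) EInf F \<longleftrightarrow> filterlim g at_infinity F"
  unfolding filterlim_at_infinity_conv_norm_at_top filterlim_at_top_dense by simp

lemma etendsto_cong:
  assumes "\<forall>\<^sub>F z in F. g z = h z"
  shows "etendsto g L F \<longleftrightarrow> etendsto h L F"
proof (cases L)
  case (Fin c)
  have "(\<forall>\<^sub>F z in F. \<exists>u. g z = Fin u \<and> dist u c < \<epsilon>)
      \<longleftrightarrow> (\<forall>\<^sub>F z in F. \<exists>u. h z = Fin u \<and> dist u c < \<epsilon>)" for \<epsilon>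
    by (rule eventually_cong[OF assms]) simp
  then show ?thesis by (simp add: Fin)
next
  case EInf
  have "(\<forall>\<^sub>F z in F. \<forall>u. g z = Fin u \<longrightarrow> R < norm u) \<longleftrightarrow> (\<forall>\<^sub>F z in F. \<forall>u. h z = Fin u \<longrightarrow> R < norm u)" for R
    by (rule eventually_cong[OF assms]) simp
  then show ?thesis by (simp add: EInf)
qed

lemma not_etendsto_Fin_EInf:
  assumes "F \<noteq> bot" "etendsto g (Fin c) F" "etendsto g EInf F"
  shows False
proof -
  have "\<forall>\<^sub>F z in F. \<exists>u. g z = Fin u \<and> dist u c < 1"
    using assms(2) by simp
  moreover have "\<forall>\<^sub>F z in F. \<forall>u. g z = Fin u \<longrightarrow> norm c + 1 < norm u"
    using assms(3) by simp
  ultimately have "\<forall>\<^sub>F z in F. False"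
  proof eventually_elim
    case (elim z)
    then obtain u where "dist u c < 1" "norm c + 1 < norm u" by blast
    then show ?case
      using norm_triangle_ineq[of "u - c" c] by (simp add: dist_norm)
  qed
  with assms(1) show False by (simp add: eventually_False)
qed

lemma etendsto_unique:
  assumes "F \<noteq> bot" "etendsto g L F" "etendsto g M F"
  shows "L = M"
proof (cases L; cases M)
  fix a b assume L: "L = Fin a" and M: "M = Fin b"
  have "\<not> 0 < dist a b"
  proof
    assume d: "0 < dist a b"
    have "\<forall>\<^sub>F z in F. \<exists>u. g z = Fin u \<and> dist u a < dist a b / 2"
      using assms(2)[unfolded L etendsto.simps] half_gt_zero[OF d] by blast
    moreover have "\<forall>\<^sub>F z in F. \<exists>u. g z = Fin u \<and> dist u b < dist a b / 2"
      using assms(3)[unfolded M etendsto.simps] half_gt_zero[OF d] by blast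
    ultimately have "\<forall>\<^sub>F z in F. False"
    proof eventually_elim
      case (elim z)
      then obtain u where "dist u a < dist a b / 2" "dist u b < dist a b / 2" by auto
      then show ?case
        using dist_triangle[of a b u] by (simp add: dist_commute)
    qed
    with assms(1) show False by (simp add: eventually_False)
  qed
  then show ?thesis by (simp add: L M)
qed (use assms not_etendsto_Fin_EInf in blast)+

text \<open>If \<open>b0 = 0\<close>, then \<open>b / a\<close> tends to 0 and the finite values of
  the quotient blow up. Points with \<open>b z = 0\<close> do no harm: there the value is
  \<open>EInf\<close>, and convergence to \<open>EInf\<close> constrains only finite values.\<close>

lemma etendsto_ediv:
  assumes a: "(a \<longlongrightarrow> a0) F" and b: "(b \<longlongrightarrow> b0) F" and ne: "a0 \<noteq> 0 \<or> b0 \<noteq> 0"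
  shows "etendsto (\<lambda>z. ediv (a z) (b z)) (ediv a0 b0) F"
proof (cases "b0 = 0")
  case False
  have "\<forall>\<^sub>F z in F. ediv (a z) (b z) = Fin (a z / b z)"
    using tendsto_imp_eventually_ne[OF b False] by eventually_elim simp
  moreover have "etendsto (\<lambda>z. Fin (a z / b z)) (ediv a0 b0) F"
    using tendsto_divide[OF a b False] False by (simp add: etendsto_Fin_Fin_iff del: etendsto.simps)
  ultimately show ?thesis by (simp add: etendsto_cong del: etendsto.simps)
next
  case True
  with ne have a0: "a0 \<noteq> 0" by simp
  have "((\<lambda>z. b z / a z) \<longlongrightarrow> 0) F"
    using tendsto_divide[OF b a a0] True by simp
  then have "\<forall>\<^sub>F z in F. norm (b z / a z) < 1 / (\<bar>R\<bar> + 1)" for R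
    using tendstoD[of "\<lambda>z. b z / a z" 0 F "1 / (\<bar>R\<bar> + 1)"] by simp
  then have "\<forall>\<^sub>F z in F. \<forall>u. ediv (a z) (b z) = Fin u \<longrightarrow> R < norm u" for R
    using tendsto_imp_eventually_ne[OF a a0]
  proof (rule eventually_elim2)
    fix z assume z: "norm (b z / a z) < 1 / (\<bar>R\<bar> + 1)" and az: "a z \<noteq> 0"
    show "\<forall>u. ediv (a z) (b z) = Fin u \<longrightarrow> R < norm u"
    proof (intro allI impI)
      fix u assume "ediv (a z) (b z) = Fin u"
      then have b0: "b z \<noteq> 0" and u: "u = a z / b z"
        by (auto split: if_splits)
      have "\<bar>R\<bar> + 1 < norm u"
        using z az b0 by (simp add: u norm_divide field_simps)
      then show "R < norm u" by linarith
    qed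
  qed
  then show ?thesis using True by simp
qed

text \<open>A Moebius map near the argument infinity: dividing numerator and denominator by
  \<open>s z\<close> leaves \<open>a + b / s\<close> over \<open>c + d / s\<close>.\<close>

lemma etendsto_ediv_moebius:
  assumes a: "(a \<longlongrightarrow> a0) F" and b: "(b \<longlongrightarrow> b0) F" and c: "(c \<longlongrightarrow> c0) F" and d: "(d \<longlongrightarrow> d0) F"
    and s: "filterlim s at_infinity F" and ne: "a0 \<noteq> 0 \<or> c0 \<noteq> 0"
  shows "etendsto (\<lambda>z. ediv (a z * s z + b z) (c z * s z + d z)) (ediv a0 c0) F"
proof -
  have "\<forall>\<^sub>F z in F. s z \<noteq> 0"
    using s by (simp add: filterlim_at_infinity_imp_eventually_ne)
  then have "\<forall>\<^sub>F z in F. ediv (a z * s z + b z) (c z * s z + d z)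
      = ediv (a z + b z / s z) (c z + d z / s z)"
  proof eventually_elim
    case (elim z)
    have "a z * s z + b z = (a z + b z / s z) * s z" "c z * s z + d z = (c z + d z / s z) * s z"
      using elim by (simp_all add: field_simps)
    then show ?case using elim by simp
  qed
  moreover have "etendsto (\<lambda>z. ediv (a z + b z / s z) (c z + d z / s z)) (ediv (a0 + 0) (c0 + 0)) F"
    using ne by (intro etendsto_ediv tendsto_add a c tendsto_divide_0[OF b s] tendsto_divide_0[OF d s]) auto
  ultimately show ?thesis by (simp add: etendsto_cong del: etendsto.simps ediv.simps)
qed

section \<open>Boundary behaviour of Nevanlinna functions\<close>

text \<open>With \<open>c\<close> the infimum of \<open>Im g(z) / Im (- 1/(z - x))\<close>, the function \<open>H = g + c/(z - x)\<close> is
  still in the class, and the quotient gets arbitrarily small for it at some point \<open>z\<^sub>0\<close>; the Schwarz-Pick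
  inequality with this \<open>z\<^sub>0\<close> bounds \<open>(z - x) H(z)\<close> near \<open>x\<close>.\<close>

lemma nevanlinna_residual_limit:
  assumes g: "g \<in> nevanlinna"
  obtains c :: real where "0 \<le> c"
    "((\<lambda>z. (z - complex_of_real x) * g z) \<longlongrightarrow> - complex_of_real c) (nontangentially x)"
proof -
  let ?x = "complex_of_real x"
  define \<rho> where "\<rho> = (\<lambda>z. Im (g z) * (norm (z - ?x))\<^sup>2 / Im z)"
  define c where "c = (INF z\<in>upper_half_plane. \<rho> z)"
  have \<rho>0: "0 \<le> \<rho> z" if "z \<in> upper_half_plane" for z
    using that g by (auto simp: \<rho>_def nevanlinna_def upper_half_plane_def)
  have ne: "upper_half_plane \<noteq> {}"
    by (auto simp: upper_half_plane_def intro: exI[of _ \<i>])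
  have bdd: "bdd_below (\<rho> ` upper_half_plane)"
    using \<rho>0 by (rule bdd_belowI2)
  have c0: "0 \<le> c"
    unfolding c_def using ne \<rho>0 by (intro cINF_greatest)
  have c_le: "c \<le> \<rho> z" if "z \<in> upper_half_plane" for z
    unfolding c_def using bdd that by (intro cINF_lower)
  have zx: "z - ?x \<noteq> 0" if "0 < Im z" for z
    using that by (auto simp: complex_eq_iff)
  define H where "H = (\<lambda>z. g z + c / (z - ?x))"
  have ImH: "Im (H z) = (\<rho> z - c) * Im z / (norm (z - ?x))\<^sup>2" if "0 < Im z" for z
  proof -
    have "Im (c / (z - ?x)) = - (c * Im z / (norm (z - ?x))\<^sup>2)"
      by (simp add: Im_divide cmod_power2)
    then have "Im (H z) = Im (g z) - c * Im z / (norm (z - ?x))\<^sup>2"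
      by (simp only: H_def plus_complex.sel)
    then show ?thesis
      using that zx[OF that] by (simp add: \<rho>_def diff_divide_distrib left_diff_distrib)
  qed
  have H: "H \<in> nevanlinna"
    unfolding nevanlinna_def
  proof (intro CollectI conjI ballI)
    show "H holomorphic_on upper_half_plane"
      unfolding H_def using g zx
      by (intro holomorphic_intros) (auto simp: nevanlinna_def upper_half_plane_def)
    show "0 \<le> Im (H z)" if "z \<in> upper_half_plane" for z
      using that c_le[OF that] by (auto simp: ImH upper_half_plane_def)
  qed
  have "((\<lambda>z. (z - ?x) * H z) \<longlongrightarrow> 0) (nontangentially x)"
  proof (rule tendsto_nontangentiallyI, rule tendstoI)
    fix a e :: real assume a: "0 < a" and e: "0 < e"
    define k where "k = a + 1"
    have k: "0 < k" using a by (simp add: k_def)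
    \<comment> \<open>The final estimate produces the factor \<open>4 * \<epsilon> * k\<close>; with
      16 this is \<open>e / 4\<close>, half of the threshold \<open>e / 2\<close> at which it gives
      a contradiction.\<close>
    define \<epsilon> where "\<epsilon> = e / (16 * k)"
    have \<epsilon>: "0 < \<epsilon>" using e k by (simp add: \<epsilon>_def)
    \<comment> \<open>A point nearly attaining the infimum: there \<open>Im H\<close> is at most
      \<open>\<epsilon>\<close> times \<open>Im (- 1/(z - x))\<close>. It stays fixed while
      \<open>z\<close> tends to \<open>x\<close>.\<close>
    have "\<exists>z\<in>upper_half_plane. \<rho> z < c + \<epsilon>"
      using cINF_less_iff[OF ne bdd, of "c + \<epsilon>"] \<epsilon> by (simp add: c_def)
    then obtain z0 where z0: "0 < Im z0" "\<rho> z0 - c < \<epsilon>"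
      by (auto simp: upper_half_plane_def)
    have n0: "0 < norm (z0 - ?x)" using zx[OF z0(1)] by simp
    have Hz0: "Im (H z0) * (norm (z0 - ?x))\<^sup>2 \<le> \<epsilon> * Im z0"
      using z0 n0 by (simp add: ImH)
    let ?F = "at ?x within stolz_angle x a"
    have id: "((\<lambda>z. z) \<longlongrightarrow> ?x) ?F" by (rule tendsto_ident_at)
    have "((\<lambda>z. (norm (z - cnj z0))\<^sup>2) \<longlongrightarrow> (norm (?x - cnj z0))\<^sup>2) ?F"
      by (intro tendsto_intros id)
    moreover have "norm (?x - cnj z0) = norm (z0 - ?x)"
      by (metis complex_cnj_cnj complex_cnj_complex_of_real complex_cnj_diff complex_mod_cnj norm_minus_commute)
    ultimately have ev1: "\<forall>\<^sub>F z in ?F. (norm (z - cnj z0))\<^sup>2 < 2 * (norm (z0 - ?x))\<^sup>2"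
      using n0 by (intro order_tendstoD) auto
    have "((\<lambda>z. norm (H z0) * norm (z - ?x)) \<longlongrightarrow> norm (H z0) * norm (?x - ?x)) ?F"
      by (intro tendsto_intros id)
    then have ev2: "\<forall>\<^sub>F z in ?F. norm (H z0) * norm (z - ?x) < e / 2"
      using e by (intro order_tendstoD) auto
    show "\<forall>\<^sub>F z in ?F. dist ((z - ?x) * H z) 0 < e"
      using ev1 ev2 eventually_in_stolz_angle
    proof eventually_elim
      case (elim z)
      have z: "0 < Im z" using elim(3) by (simp add: stolz_angle_def)
      have nz: "norm (z - ?x) \<le> k * Im z"
        using norm_stolz_angle[OF elim(3)] by (simp add: k_def)
      define D where "D = norm (H z - cnj (H z0))"
      have D0: "0 \<le> D" by (simp add: D_def)
      have nH: "norm (H z) \<le> D + norm (H z0)"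
        using norm_triangle_ineq[of "H z - cnj (H z0)" "cnj (H z0)"] by (simp add: D_def)
      have ImHz: "0 \<le> Im (H z)" "0 \<le> Im (H z0)"
        using H z z0(1) by (auto simp: nevanlinna_def upper_half_plane_def)
      have "D\<^sup>2 * Im z * Im z0 \<le> (norm (z - cnj z0))\<^sup>2 * (Im (H z) * Im (H z0))"
        using schwarz_pick[OF H z z0(1)] by (simp add: D_def mult.assoc)
      also have "\<dots> \<le> 2 * (norm (z0 - ?x))\<^sup>2 * (Im (H z) * Im (H z0))"
        using elim(1) ImHz by (intro mult_right_mono) auto
      also have "\<dots> = 2 * Im (H z) * (Im (H z0) * (norm (z0 - ?x))\<^sup>2)"
        by simp
      also have "\<dots> \<le> 2 * Im (H z) * (\<epsilon> * Im z0)"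
        using ImHz by (intro mult_left_mono Hz0) auto
      also have "\<dots> = 2 * \<epsilon> * Im (H z) * Im z0" by simp
      finally have "D\<^sup>2 * Im z \<le> 2 * \<epsilon> * Im (H z)"
        using z0(1) by simp
      also have "\<dots> \<le> 2 * \<epsilon> * (D + norm (H z0))"
        using \<epsilon> nH abs_Im_le_cmod[of "H z"] by (intro mult_left_mono) auto
      finally have 1: "D\<^sup>2 * Im z \<le> 2 * \<epsilon> * (D + norm (H z0))" .
      define E where "E = D * norm (z - ?x)"
      have "E < e / 2"
      \<comment> \<open>An absorption argument. If \<open>E\<close> were at least
        \<open>e / 2\<close>, it would dominate the term with \<open>H z0\<close>, and the
        inequality, quadratic in \<open>E\<close> on the left and now linear on the right, would
        give \<open>E \<le> e / 4\<close>.\<close>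
      proof (rule ccontr)
        assume "\<not> E < e / 2"
        then have E: "e / 2 \<le> E" by simp
        have "E\<^sup>2 * Im z = (D\<^sup>2 * Im z) * (norm (z - ?x))\<^sup>2"
          by (simp add: E_def power_mult_distrib)
        also have "\<dots> \<le> (2 * \<epsilon> * (D + norm (H z0))) * (norm (z - ?x))\<^sup>2"
          by (intro mult_right_mono 1) auto
        also have "\<dots> = (2 * \<epsilon> * (E + norm (H z0) * norm (z - ?x))) * norm (z - ?x)"
          by (simp add: E_def power2_eq_square algebra_simps)
        also have "\<dots> \<le> (2 * \<epsilon> * (E + E)) * (k * Im z)"
          using elim(2) E \<epsilon> e nz D0 by (intro mult_mono) (auto simp: E_def)
        also have "\<dots> = e / 4 * E * Im z"
          using k by (simp add: \<epsilon>_def)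
        finally have "E * E \<le> e / 4 * E"
          using z mult_right_le_imp_le[of "E * E" "Im z" "e / 4 * E"] by (simp only: power2_eq_square)
        then show False using E e by simp
      qed
      moreover have "norm ((z - ?x) * H z) \<le> E + norm (H z0) * norm (z - ?x)"
        using mult_right_mono[OF nH, of "norm (z - ?x)"]
        unfolding norm_mult E_def by (simp add: algebra_simps)
      ultimately show ?case using elim(2) by simp
    qed
  qed
  then have "((\<lambda>z. (z - ?x) * H z - c) \<longlongrightarrow> 0 - complex_of_real c) (nontangentially x)"
    by (intro tendsto_intros)
  moreover have "\<forall>\<^sub>F z in nontangentially x. (z - ?x) * H z - c = (z - ?x) * g z"
    using eventually_Im_pos_nontangentially
    by eventually_elim (use zx in \<open>auto simp: H_def distrib_left\<close>)
  ultimately have "((\<lambda>z. (z - ?x) * g z) \<longlongrightarrow> - complex_of_real c) (nontangentially x)"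
    by (simp add: tendsto_cong)
  with c0 show ?thesis by (rule that)
qed

text \<open>Apply the preceding lemma to \<open>- 1/(f - \<eta>)\<close>.\<close>

lemma nevanlinna_quotient_limit:
  assumes f: "f \<in> nevanlinna"
  shows "(\<exists>d::real. 0 \<le> d \<and> ((\<lambda>z. (f z - complex_of_real \<eta>) / (z - complex_of_real x))
      \<longlongrightarrow> complex_of_real d) (nontangentially x))
    \<or> filterlim (\<lambda>z. (f z - complex_of_real \<eta>) / (z - complex_of_real x))
        at_infinity (nontangentially x)"
proof (cases "\<exists>z. 0 < Im z \<and> f z = complex_of_real \<eta>")
  case True
  then obtain z0 where z0: "0 < Im z0" "f z0 = complex_of_real \<eta>" by blast
  have "\<forall>\<^sub>F z in nontangentially x. (f z - complex_of_real \<eta>) / (z - complex_of_real x) = 0"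
    using eventually_Im_pos_nontangentially
  proof eventually_elim
    case (elim z)
    show ?case
      using nevanlinna_real_value_const[OF f z0(1) _ elim] z0(2) by simp
  qed
  then have "((\<lambda>z. (f z - complex_of_real \<eta>) / (z - complex_of_real x))
      \<longlongrightarrow> complex_of_real 0) (nontangentially x)"
    unfolding of_real_0 by (rule tendsto_eventually)
  then show ?thesis by (intro disjI1 exI[of _ 0]) simp
next
  case False
  let ?F = "nontangentially x"
  let ?g = "\<lambda>z. - 1 / (f z - complex_of_real \<eta>)"
  let ?p = "\<lambda>z. (z - complex_of_real x) / (f z - complex_of_real \<eta>)"
  let ?q = "\<lambda>z. (f z - complex_of_real \<eta>) / (z - complex_of_real x)"
  have "?g \<in> nevanlinna"
    unfolding nevanlinna_def
  proof (intro CollectI conjI ballI)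
    show "?g holomorphic_on upper_half_plane"
      using f False by (intro holomorphic_intros) (auto simp: nevanlinna_def upper_half_plane_def)
    show "0 \<le> Im (?g z)" if "z \<in> upper_half_plane" for z
      using f that by (auto simp: nevanlinna_def Im_divide)
  qed
  then obtain c where c: "0 \<le> c" "((\<lambda>z. (z - complex_of_real x) * ?g z) \<longlongrightarrow> - complex_of_real c) ?F"
    by (rule nevanlinna_residual_limit)
  from tendsto_minus[OF c(2)] have p: "(?p \<longlongrightarrow> complex_of_real c) ?F"
    by simp
  have q: "?q = (\<lambda>z. inverse (?p z))" by (simp add: fun_eq_iff)
  show ?thesis
  \<comment> \<open>As \<open>?q\<close> is the reciprocal of \<open>?p\<close>, the case
    \<open>c = 0\<close> is the infinite one, and otherwise \<open>d = 1/c\<close> is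
    positive.\<close>
  proof (cases "c = 0")
    case True
    have "\<forall>\<^sub>F z in ?F. ?p z \<noteq> 0"
      using eventually_Im_pos_nontangentially by eventually_elim (use False in auto)
    with p True have "filterlim ?p (at 0) ?F"
      by (simp add: filterlim_at)
    then have "filterlim ?q at_infinity ?F"
      unfolding q by (rule filterlim_compose[OF filterlim_inverse_at_infinity])
    then show ?thesis ..
  next
    case False
    with p have "(?q \<longlongrightarrow> inverse (complex_of_real c)) ?F"
      unfolding q by (intro tendsto_inverse) auto
    then show ?thesis
      using c(1) by (intro disjI1 exI[of _ "inverse c"]) auto
  qed
qed

section \<open>Value, derivative and kernel in terms of the difference quotient\<close>

lemma tendsto_of_quotient:
  assumes "((\<lambda>z. (f z - complex_of_real \<eta>) / (z - complex_of_real x)) \<longlongrightarrow> d) (nontangentially x)"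
  shows "(f \<longlongrightarrow> complex_of_real \<eta>) (nontangentially x)"
proof -
  have "((\<lambda>z. (f z - complex_of_real \<eta>) / (z - complex_of_real x) * (z - complex_of_real x) + complex_of_real \<eta>)
      \<longlongrightarrow> d * (complex_of_real x - complex_of_real x) + complex_of_real \<eta>) (nontangentially x)"
    by (intro tendsto_intros assms tendsto_nontangentially_ident)
  moreover have "\<forall>\<^sub>F z in nontangentially x.
      (f z - complex_of_real \<eta>) / (z - complex_of_real x) * (z - complex_of_real x) + complex_of_real \<eta>
          = f z"
    using eventually_Im_pos_nontangentially by eventually_elim auto
  ultimately show ?thesis by (simp add: tendsto_cong)
qed

text \<open>The remainder \<open>h = f - \<eta> - d (\<zeta> - x)\<close> is small compared with the
  distance from \<open>x\<close>. The Cauchy inequality on a disc of radius \<open>Im z / 2\<close>,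
  which is comparable to that distance, makes its derivative small. The disc leaves the given angle,
  so a wider one is needed.\<close>

lemma deriv_tendsto_of_quotient:
  assumes hol: "f holomorphic_on upper_half_plane"
    and q: "((\<lambda>z. (f z - complex_of_real \<eta>) / (z - complex_of_real x)) \<longlongrightarrow> d) (nontangentially x)"
  shows "(deriv f \<longlongrightarrow> d) (nontangentially x)"
proof (rule tendsto_nontangentiallyI, rule tendstoI)
  fix a e :: real assume a: "0 < a" and e: "0 < e"
  let ?x = "complex_of_real x"
  \<comment> \<open>On the disc, \<open>|Re \<zeta> - x| < (a + 1/2) Im z\<close> and
    \<open>Im \<zeta> \<ge> Im z / 2\<close>, which gives the aperture \<open>2 a + 1\<close>. The
    Cauchy bound will be \<open>3 \<epsilon> (a + 1)\<close>, and the 4 in the next line keeps it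
    below \<open>e\<close>.\<close>
  define b where "b = 2 * a + 1"
  define \<epsilon> where "\<epsilon> = e / (4 * (a + 1))"
  have b: "0 < b" and \<epsilon>: "0 < \<epsilon>" using a e by (auto simp: b_def \<epsilon>_def)
  obtain r where r: "0 < r" and qr: "\<And>z. z \<in> stolz_angle x b \<Longrightarrow> dist z ?x < r \<Longrightarrow>
      dist ((f z - complex_of_real \<eta>) / (z - ?x)) d < \<epsilon>"
    using tendsto_nontangentiallyD[OF q b \<epsilon>] by blast
  have op: "open upper_half_plane"
    unfolding upper_half_plane_def by (rule open_halfspace_Im_gt)
  have "((\<lambda>z. norm (z - ?x)) \<longlongrightarrow> norm (?x - ?x)) (at ?x within stolz_angle x a)"
    by (intro tendsto_intros)
  then have "\<forall>\<^sub>F z in at ?x within stolz_angle x a. norm (z - ?x) < r / 2"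
    using r by (intro order_tendstoD) auto
  then show "\<forall>\<^sub>F z in at ?x within stolz_angle x a. dist (deriv f z) d < e"
    using eventually_in_stolz_angle
  proof eventually_elim
    case (elim z)
    have z: "0 < Im z" using elim(2) by (simp add: stolz_angle_def)
    have nz: "norm (z - ?x) \<le> (a + 1) * Im z"
      by (rule norm_stolz_angle[OF elim(2)])
    have Imz: "Im z \<le> norm (z - ?x)"
      using abs_Im_le_cmod[of "z - ?x"] by simp
    define h where "h = (\<lambda>\<zeta>. f \<zeta> - complex_of_real \<eta> - d * (\<zeta> - ?x))"
    let ?r = "Im z / 2"
    have ball: "0 < Im \<zeta> \<and> \<zeta> \<in> stolz_angle x b \<and> dist \<zeta> ?x < r \<and> norm (\<zeta> - ?x) \<le> 3 / 2 * norm (z - ?x)"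
      if "\<zeta> \<in> cball z ?r" for \<zeta>
    proof -
      have n: "norm (\<zeta> - z) \<le> ?r" using that by (simp add: dist_norm norm_minus_commute)
      have "\<bar>Im \<zeta> - Im z\<bar> \<le> ?r" "\<bar>Re \<zeta> - Re z\<bar> \<le> ?r"
        using n abs_Im_le_cmod[of "\<zeta> - z"] abs_Re_le_cmod[of "\<zeta> - z"] by auto
      then have I: "Im z / 2 \<le> Im \<zeta>" and R: "\<bar>Re \<zeta> - x\<bar> < a * Im z + Im z / 2"
        using elim(2) unfolding stolz_angle_def mem_Collect_eq by linarith+
      have "a * Im z + Im z / 2 = b * (Im z / 2)" by (simp add: b_def algebra_simps)
      also have "\<dots> \<le> b * Im \<zeta>" using I b by (intro mult_left_mono) auto
      finally have "\<zeta> \<in> stolz_angle x b" using I z R by (auto simp: stolz_angle_def)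
      moreover have "norm (\<zeta> - ?x) \<le> 3 / 2 * norm (z - ?x)"
        using norm_triangle_ineq[of "\<zeta> - z" "z - ?x"] n Imz by simp
      ultimately show ?thesis using I z elim(1) r by (auto simp: dist_norm)
    qed
    have sub: "cball z ?r \<subseteq> upper_half_plane"
      using ball by (auto simp: upper_half_plane_def)
    have holh: "h holomorphic_on cball z ?r"
      unfolding h_def using hol sub by (intro holomorphic_intros) (auto intro: holomorphic_on_subset)
    have bd: "norm (h \<zeta>) \<le> \<epsilon> * (3 / 2 * norm (z - ?x))" if "\<zeta> \<in> cball z ?r" for \<zeta>
    proof -
      have nx: "\<zeta> - ?x \<noteq> 0" using ball[OF that] by (auto simp: complex_eq_iff)
      have "h \<zeta> = ((f \<zeta> - complex_of_real \<eta>) / (\<zeta> - ?x) - d) * (\<zeta> - ?x)"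
        using nx by (simp add: h_def field_simps)
      then have "norm (h \<zeta>) = dist ((f \<zeta> - complex_of_real \<eta>) / (\<zeta> - ?x)) d * norm (\<zeta> - ?x)"
        by (simp add: norm_mult dist_norm)
      also have "\<dots> \<le> \<epsilon> * (3 / 2 * norm (z - ?x))"
        using qr[of \<zeta>] ball[OF that] \<epsilon> by (intro mult_mono) auto
      finally show ?thesis .
    qed
    have "norm ((deriv ^^ 1) h z) \<le> fact 1 * (\<epsilon> * (3 / 2 * norm (z - ?x))) / ?r ^ 1"
      using z holh
      by (intro Cauchy_inequality bd)
        (auto intro: holomorphic_on_subset holomorphic_on_imp_continuous_on simp: dist_norm norm_minus_commute)
    also have "\<dots> = 3 * \<epsilon> * norm (z - ?x) / Im z" using z by simp
    also have "\<dots> \<le> 3 * \<epsilon> * (a + 1)"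
      using mult_left_mono[of "norm (z - ?x) / Im z" "a + 1" "3 * \<epsilon>"] nz z \<epsilon>
      by (simp add: divide_le_eq)
    also have "\<dots> < e" using a e by (simp add: \<epsilon>_def field_simps add_pos_pos)
    finally have "norm (deriv h z) < e" by simp
    moreover have "deriv h z = deriv f z - d"
    proof -
      have "(f has_field_derivative deriv f z) (at z)"
        using hol op z by (intro holomorphic_derivI) (auto simp: upper_half_plane_def)
      then have "(h has_field_derivative (deriv f z - d)) (at z)"
        unfolding h_def by (auto intro!: derivative_eq_intros)
      then show ?thesis by (simp add: DERIV_imp_deriv)
    qed
    ultimately show ?case by (simp add: dist_norm)
  qed
qed

text \<open>A convergent derivative is bounded near \<open>x\<close> in an angle, so
  \<open>f\<close> is Lipschitz there. Letting the second point tend to \<open>x\<close> bounds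
  \<open>q\<close> in this angle, and one angle suffices to refute an infinite nontangential
  limit.\<close>

lemma quotient_not_at_infinity_of_deriv:
  assumes hol: "f holomorphic_on upper_half_plane"
    and f: "(f \<longlongrightarrow> complex_of_real \<eta>) (nontangentially x)"
    and f': "(deriv f \<longlongrightarrow> d) (nontangentially x)"
  shows "\<not> filterlim (\<lambda>z. (f z - complex_of_real \<eta>) / (z - complex_of_real x))
      at_infinity (nontangentially x)"
proof
  let ?x = "complex_of_real x" and ?S = "stolz_angle x 1"
  let ?q = "\<lambda>z. (f z - complex_of_real \<eta>) / (z - ?x)"
  let ?F = "at ?x within ?S"
  assume "filterlim ?q at_infinity (nontangentially x)"
  then have q: "filterlim ?q at_infinity ?F"
    using at_within_stolz_angle_le_nontangentially[of 1 x] by (auto intro: filterlim_mono)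
  define B where "B = norm d + 1"
  obtain r where r: "0 < r" "\<And>z. z \<in> ?S \<Longrightarrow> dist z ?x < r \<Longrightarrow> dist (deriv f z) d < 1"
    using tendsto_nontangentiallyD[OF f', of 1 1] by auto
  let ?C = "?S \<inter> ball ?x r"
  \<comment> \<open>Writing the angle as an intersection of three half-planes shows that it is
    convex, as the mean value bound requires.\<close>
  have S: "?S = {z. 0 < Im z} \<inter> ({z. Re z - Im z < x} \<inter> {z. x < Re z + Im z})"
    by (auto simp: stolz_angle_def)
  have "convex {z. Re z - Im z < x}" "convex {z. x < Re z + Im z}"
    using convex_halfspace_lt[of "1 - \<i>" x] convex_halfspace_gt[of x "1 + \<i>"]
    by (simp_all add: inner_complex_def)
  then have conv: "convex ?C"
    unfolding S by (intro convex_Int convex_halfspace_Im_gt convex_ball)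
  have bound: "norm (f z - f w) \<le> B * norm (z - w)" if "z \<in> ?C" "w \<in> ?C" for z w
  proof (rule field_differentiable_bound[OF conv])
    fix u assume u: "u \<in> ?C"
    then have "0 < Im u" by (simp add: stolz_angle_def)
    then show "(f has_field_derivative deriv f u) (at u within ?C)"
      using holomorphic_derivI[OF hol[unfolded upper_half_plane_def] open_halfspace_Im_gt]
      by (simp add: has_field_derivative_at_within)
    show "norm (deriv f u) \<le> B"
      using r(2)[of u] u norm_triangle_ineq[of "deriv f u - d" d]
      by (auto simp: B_def dist_norm norm_minus_commute)
  qed (use that in auto)
  have inC: "\<forall>\<^sub>F z in ?F. z \<in> ?C"
  proof -
    have "\<forall>\<^sub>F z in ?F. z \<in> ball ?x r"
      using r(1) topological_tendstoD[OF tendsto_ident_at, of "ball ?x r"] by auto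
    then show ?thesis
      using eventually_in_stolz_angle[of x 1] by eventually_elim auto
  qed
  have fF: "(f \<longlongrightarrow> complex_of_real \<eta>) ?F"
    using f by (auto simp: tendsto_nontangentially_iff)
  have "norm (f z - complex_of_real \<eta>) \<le> B * norm (z - ?x)" if "z \<in> ?C" for z
  proof (rule tendsto_le)
    show "((\<lambda>w. norm (f z - f w)) \<longlongrightarrow> norm (f z - complex_of_real \<eta>)) ?F"
      by (intro tendsto_intros fF)
    show "((\<lambda>w. B * norm (z - w)) \<longlongrightarrow> B * norm (z - ?x)) ?F"
      by (intro tendsto_intros)
    show "\<forall>\<^sub>F w in ?F. norm (f z - f w) \<le> B * norm (z - w)"
      using inC by eventually_elim (use bound that in auto)
    show "?F \<noteq> bot"
      by (rule at_within_stolz_angle_neq_bot) simp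
  qed
  then have "\<forall>\<^sub>F z in ?F. norm (?q z) \<le> B"
    using inC by (auto elim!: eventually_mono simp: norm_divide divide_le_eq B_def add_nonneg_pos)
  moreover have "\<forall>\<^sub>F z in ?F. B < norm (?q z)"
    using q unfolding filterlim_at_infinity_conv_norm_at_top filterlim_at_top_dense by blast
  ultimately have "\<forall>\<^sub>F z in ?F. False" by eventually_elim simp
  then show False
    using at_within_stolz_angle_neq_bot[of 1 x] by (simp add: eventually_False)
qed

lemma nev_kernel_diag: "nev_kernel f z z = complex_of_real (Im (f z) / Im z)"
  by (simp add: nev_kernel_def complex_diff_cnj)

text \<open>As \<open>\<eta>\<close>, \<open>x\<close> and \<open>d\<close> are real,
  \<open>K - d\<close> equals \<open>Im ((q - d) (z - x)) / Im z\<close>, and in an angle this is at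
  most \<open>(a + 1) |q - d|\<close>.\<close>

lemma nev_kernel_tendsto_of_quotient:
  fixes d :: real
  assumes q: "((\<lambda>z. (f z - complex_of_real \<eta>) / (z - complex_of_real x))
      \<longlongrightarrow> complex_of_real d) (nontangentially x)"
  shows "((\<lambda>z. nev_kernel f z z) \<longlongrightarrow> complex_of_real d) (nontangentially x)"
proof (rule tendsto_nontangentiallyI)
  fix a :: real assume a: "0 < a"
  let ?x = "complex_of_real x"
  let ?q = "\<lambda>z. (f z - complex_of_real \<eta>) / (z - ?x)"
  let ?F = "at ?x within stolz_angle x a"
  have "(?q \<longlongrightarrow> complex_of_real d) ?F"
    using q a by (simp add: tendsto_nontangentially_iff)
  then have "((\<lambda>z. (a + 1) * norm (?q z - d)) \<longlongrightarrow> (a + 1) * norm (complex_of_real d - d)) ?F"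
    by (intro tendsto_intros)
  then have lim: "((\<lambda>z. (a + 1) * norm (?q z - d)) \<longlongrightarrow> 0) ?F"
    by simp
  have "\<forall>\<^sub>F z in ?F. norm (nev_kernel f z z - d) \<le> (a + 1) * norm (?q z - d)"
    using eventually_in_stolz_angle
  proof eventually_elim
    case (elim z)
    have z: "0 < Im z" using elim by (simp add: stolz_angle_def)
    then have n: "z - ?x \<noteq> 0" by (auto simp: complex_eq_iff)
    have "nev_kernel f z z - d = complex_of_real ((Im (f z) - d * Im z) / Im z)"
      using z by (simp add: nev_kernel_diag field_simps)
    also have "Im (f z) - d * Im z = Im ((?q z - d) * (z - ?x))"
      unfolding left_diff_distrib[of "?q z"] using n by simp
    finally have "norm (nev_kernel f z z - d) = \<bar>Im ((?q z - d) * (z - ?x))\<bar> / Im z"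
      using z by (simp add: norm_of_real del: times_divide_eq_left of_real_divide)
    also have "\<dots> \<le> norm ((?q z - d) * (z - ?x)) / Im z"
      using z by (intro divide_right_mono abs_Im_le_cmod) auto
    also have "\<dots> \<le> norm (?q z - d) * ((a + 1) * Im z) / Im z"
      unfolding norm_mult using z norm_stolz_angle[OF elim]
      by (intro divide_right_mono mult_left_mono) auto
    finally show ?case using z by (simp add: mult.commute)
  qed
  then have "((\<lambda>z. nev_kernel f z z - d) \<longlongrightarrow> 0) ?F"
    using lim by (rule Lim_null_comparison)
  then show "((\<lambda>z. nev_kernel f z z) \<longlongrightarrow> complex_of_real d) ?F"
    by (rule Lim_null[THEN iffD2])
qed

text \<open>If the kernel stays below \<open>R\<close> along some approach to \<open>x\<close>, then passing to the limit in the second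
  variable of the Schwarz-Pick inequality gives \<open>|f(z) - \<eta>| Im z \<le> R |z - x|\<^sup>2\<close>.\<close>

lemma nev_kernel_at_infinity_of_quotient:
  assumes f: "f \<in> nevanlinna"
    and lim: "(f \<longlongrightarrow> complex_of_real \<eta>) (nontangentially x)"
    and q: "filterlim (\<lambda>z. (f z - complex_of_real \<eta>) / (z - complex_of_real x))
        at_infinity (nontangentially x)"
  shows "filterlim (\<lambda>z. nev_kernel f z z) at_infinity (nontangentially x)"
proof (rule ccontr)
  let ?x = "complex_of_real x" and ?N = "nontangentially x"
  let ?q = "\<lambda>z. (f z - complex_of_real \<eta>) / (z - ?x)"
  have Imf: "0 \<le> Im (f z)" if "0 < Im z" for z
    using f that by (auto simp: nevanlinna_def upper_half_plane_def)
  assume "\<not> ?thesis"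
  then have "\<not> filterlim (\<lambda>z. norm (nev_kernel f z z)) at_top ?N"
    unfolding filterlim_at_infinity_conv_norm_at_top .
  then obtain R where "\<not> (\<forall>\<^sub>F z in ?N. R < norm (nev_kernel f z z))"
    by (auto simp: filterlim_at_top_dense)
  \<comment> \<open>Failure of the blow-up bounds the kernel only frequently, not eventually. This
    is enough, since it is used only to keep a convergent quantity from having a negative
    limit.\<close>
  then have fr: "\<exists>\<^sub>F \<zeta> in ?N. norm (nev_kernel f \<zeta> \<zeta>) \<le> R"
    by (simp add: frequently_def not_le)
  then have R: "0 \<le> R"
    using norm_ge_zero order_trans by (blast dest: frequently_ex)
  have key: "norm (f z - complex_of_real \<eta>) * Im z \<le> R * (norm (z - ?x))\<^sup>2" if z: "0 < Im z" for z
  proof -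
    let ?l = "\<lambda>\<zeta>. (norm (f z - cnj (f \<zeta>)))\<^sup>2 * Im z"
    let ?r = "\<lambda>\<zeta>. (norm (z - cnj \<zeta>))\<^sup>2 * (Im (f z) * R)"
    have "(?l \<longlongrightarrow> (norm (f z - cnj (complex_of_real \<eta>)))\<^sup>2 * Im z) ?N"
      by (intro tendsto_intros lim)
    moreover have "(?r \<longlongrightarrow> (norm (z - cnj ?x))\<^sup>2 * (Im (f z) * R)) ?N"
      by (intro tendsto_intros tendsto_nontangentially_ident)
    ultimately have lims: "((\<lambda>\<zeta>. ?r \<zeta> - ?l \<zeta>) \<longlongrightarrow> (norm (z - ?x))\<^sup>2 * (Im (f z) * R)
        - (norm (f z - complex_of_real \<eta>))\<^sup>2 * Im z) ?N"
      using tendsto_diff by fastforce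
    have fr': "\<exists>\<^sub>F \<zeta> in ?N. 0 \<le> ?r \<zeta> - ?l \<zeta>"
      using frequently_eventually_frequently[OF fr eventually_Im_pos_nontangentially]
    proof (rule frequently_mono[rotated], safe)
      fix \<zeta> assume K: "norm (nev_kernel f \<zeta> \<zeta>) \<le> R" and \<zeta>: "0 < Im \<zeta>"
      have "Im (f \<zeta>) \<le> R * Im \<zeta>"
        using K \<zeta> Imf[OF \<zeta>] by (simp add: nev_kernel_diag norm_divide divide_le_eq)
      then have "(norm (z - cnj \<zeta>))\<^sup>2 * (Im (f z) * Im (f \<zeta>))
          \<le> (norm (z - cnj \<zeta>))\<^sup>2 * (Im (f z) * (R * Im \<zeta>))"
        using Imf[OF z] by (intro mult_left_mono) auto
      with schwarz_pick[OF f z \<zeta>] have "?l \<zeta> * Im \<zeta> \<le> ?r \<zeta> * Im \<zeta>"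
        by (simp add: algebra_simps)
      with \<zeta> show "0 \<le> ?r \<zeta> - ?l \<zeta>" by simp
    qed
    have "0 \<le> (norm (z - ?x))\<^sup>2 * (Im (f z) * R) - (norm (f z - complex_of_real \<eta>))\<^sup>2 * Im z"
    proof (rule ccontr)
      assume "\<not> ?thesis"
      then have "\<forall>\<^sub>F \<zeta> in ?N. ?r \<zeta> - ?l \<zeta> < 0"
        using lims by (intro order_tendstoD) auto
      with fr' show False by (simp add: frequently_def not_le)
    qed
    \<comment> \<open>This replaces \<open>Im (f z)\<close> on the right by
      \<open>|f z - \<eta>|\<close>, so that one such factor cancels from the squared norm on the
      left.\<close>
    moreover have "Im (f z) \<le> norm (f z - complex_of_real \<eta>)"
      using abs_Im_le_cmod[of "f z - complex_of_real \<eta>"] by simp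
    then have "(norm (z - ?x))\<^sup>2 * (Im (f z) * R)
        \<le> (norm (z - ?x))\<^sup>2 * (norm (f z - complex_of_real \<eta>) * R)"
      using R by (intro mult_left_mono mult_right_mono) auto
    ultimately have "norm (f z - complex_of_real \<eta>) * (norm (f z - complex_of_real \<eta>) * Im z)
        \<le> norm (f z - complex_of_real \<eta>) * (R * (norm (z - ?x))\<^sup>2)"
      by (simp add: power2_eq_square algebra_simps)
    then show ?thesis
      using R by (cases "f z = complex_of_real \<eta>") (auto simp: mult_le_cancel_left)
  qed
  let ?F = "at ?x within stolz_angle x 1"
  have "\<forall>\<^sub>F z in ?F. norm (?q z) \<le> 2 * R"
    using eventually_in_stolz_angle
  proof eventually_elim
    case (elim z)
    have z: "0 < Im z" using elim by (simp add: stolz_angle_def)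
    then have n: "0 < norm (z - ?x)" by (auto simp: complex_eq_iff)
    have "norm (f z - complex_of_real \<eta>) * norm (z - ?x) \<le> norm (f z - complex_of_real \<eta>) * (2 * Im z)"
      using norm_stolz_angle[OF elim] by (intro mult_left_mono) auto
    also have "\<dots> \<le> 2 * R * norm (z - ?x) * norm (z - ?x)"
      using key[OF z] by (simp add: power2_eq_square algebra_simps)
    finally show ?case
      using n by (simp add: norm_divide divide_le_eq)
  qed
  moreover have "filterlim ?q at_infinity ?F"
    using at_within_stolz_angle_le_nontangentially[of 1 x] q by (auto intro: filterlim_mono)
  then have "\<forall>\<^sub>F z in ?F. 2 * R < norm (?q z)"
    unfolding filterlim_at_infinity_conv_norm_at_top filterlim_at_top_dense by blast
  ultimately have "\<forall>\<^sub>F z in ?F. False" by eventually_elim simp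
  then show False
    using at_within_stolz_angle_neq_bot[of 1 x] by (simp add: eventually_False)
qed

section \<open>The Pick matrix and the coefficient matrix\<close>

text \<open>\<open>mat_inverse\<close> is specified through the units of the ring of square
  matrices, whereas \<open>invertible_mat\<close> leaves the shape of the inverse open; comparing
  dimensions in the two product identities fixes it.\<close>

lemma minv_invertible:
  fixes A :: "'a::field mat"
  assumes A: "A \<in> carrier_mat n n" and inv: "invertible_mat A"
  shows "minv A \<in> carrier_mat n n" "A * minv A = 1\<^sub>m n" "minv A * A = 1\<^sub>m n"
proof -
  obtain B where AB: "A * B = 1\<^sub>m (dim_row A)" and BA: "B * A = 1\<^sub>m (dim_row B)"
    using inv by (auto simp: invertible_mat_def inverts_mat_def)
  have "dim_col B = n"
    using arg_cong[OF AB, of dim_col] A by auto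
  moreover have "dim_row B = n"
    using arg_cong[OF BA, of dim_col] A by auto
  ultimately have "A \<in> Units (ring_mat TYPE('a) n ())"
    using A AB BA by (auto simp: Units_def ring_mat_def)
  then obtain C where C: "mat_inverse A = Some C"
    using mat_inverse(1)[OF A, where b = "()"] by (cases "mat_inverse A") auto
  show "minv A \<in> carrier_mat n n" "A * minv A = 1\<^sub>m n" "minv A * A = 1\<^sub>m n"
    using mat_inverse(2)[OF A C] C by (auto simp: minv_def)
qed

lemma minv_eqI:
  fixes A :: "'a::field mat"
  assumes A: "A \<in> carrier_mat n n" and B: "B \<in> carrier_mat n n" and AB: "A * B = 1\<^sub>m n" "B * A = 1\<^sub>m n"
  shows "minv A = B"
proof -
  have "invertible_mat A"
    using A B AB by (auto simp: invertible_mat_def inverts_mat_def)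
  note m = minv_invertible[OF A this]
  have "minv A = (B * A) * minv A"
    using m(1) AB by simp
  also have "\<dots> = B"
    using assoc_mult_mat[OF B A m(1)] m(2) B by simp
  finally show ?thesis .
qed

lemma minv_mat_diag:
  fixes f :: "nat \<Rightarrow> 'a::field"
  assumes "\<And>i. i < n \<Longrightarrow> f i \<noteq> 0"
  shows "minv (mat_diag n f) = mat_diag n (\<lambda>i. 1 / f i)"
proof (rule minv_eqI[of _ n])
  have "mat_diag n (\<lambda>i. f i * (1 / f i)) = 1\<^sub>m n" "mat_diag n (\<lambda>i. 1 / f i * f i) = 1\<^sub>m n"
    using assms by (auto simp: mat_diag_def)
  then show "mat_diag n f * mat_diag n (\<lambda>i. 1 / f i) = 1\<^sub>m n" "mat_diag n (\<lambda>i. 1 / f i) * mat_diag n f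
      = 1\<^sub>m n"
    by (simp_all add: mat_diag_diag)
qed (auto simp: mat_diag_def)

lemma mult_mat_2_index:
  assumes "M \<in> carrier_mat 2 2" "N \<in> carrier_mat 2 2" "a < 2" "b < 2"
  shows "(M * N) $$ (a, b) = M $$ (a, 0) * N $$ (0, b) + M $$ (a, Suc 0) * N $$ (Suc 0, b)"
proof -
  have "{0..<2::nat} = {0, Suc 0}" by auto
  then show ?thesis using assms by (simp add: scalar_prod_def)
qed

lemma minv_symmetric:
  fixes A :: "'a::field mat"
  assumes A: "A \<in> carrier_mat n n" and inv: "invertible_mat A" and sym: "transpose_mat A = A"
  shows "transpose_mat (minv A) = minv A"
proof -
  note m = minv_invertible[OF A inv]
  have "A * transpose_mat (minv A) = transpose_mat (minv A * A)"
    using transpose_mult[OF m(1) A] sym by simp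
  moreover have "transpose_mat (minv A) * A = transpose_mat (A * minv A)"
    using transpose_mult[OF A m(1)] sym by simp
  ultimately show ?thesis
    using m A by (intro minv_eqI[symmetric, of _ n]) auto
qed

section \<open>Entrywise form of the data and of the Lyapunov identity\<close>

definition c_entry :: "interp_data \<Rightarrow> nat \<Rightarrow> real" where
  "c_entry D k = (if k < num_regular D then target D k else xi D k)"

definition e_entry :: "interp_data \<Rightarrow> nat \<Rightarrow> real" where
  "e_entry D k = (if k < num_regular D then 1 else 0)"

definition pick_inv :: "interp_data \<Rightarrow> nat \<Rightarrow> nat \<Rightarrow> real" where
  "pick_inv D i j = minv (pick_matrix D) $$ (i, j)"

text \<open>The scalar \<open>u (z I - X)^(-1) v^T\<close> for row vectors \<open>u\<close> and
  \<open>v\<close>. Up to sign and the identity matrix, every entry of \<open>Theta\<close> has this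
  form.\<close>

definition resolvent_sum :: "interp_data \<Rightarrow> (nat \<Rightarrow> real) \<Rightarrow> (nat \<Rightarrow> real) \<Rightarrow> complex \<Rightarrow> complex" where
  "resolvent_sum D u v z = (\<Sum>k<num_nodes D. complex_of_real (u k * v k) / (z
      - complex_of_real (node D k)))"

lemma pick_entry_sym: "pick_entry D i j = pick_entry D j i"
  by (auto simp: pick_entry_def minus_divide_divide[symmetric, of "target D j - target D i"])

text \<open>The Lyapunov identity \<open>P X - X P = E\<^sup>* C - C\<^sup>* E\<close>.\<close>

lemma pick_lyapunov:
  assumes "valid_data D" "i < num_nodes D" "j < num_nodes D"
  shows "(node D j - node D i) * pick_entry D i j
      = e_entry D i * c_entry D j - c_entry D i * e_entry D j"
proof (cases "i = j")
  case False
  then have "node D j \<noteq> node D i"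
    using assms by (auto simp: valid_data_def inj_on_def)
  then show ?thesis
    by (auto simp: pick_entry_def e_entry_def c_entry_def field_simps)
qed simp

context
  fixes D :: interp_data
  assumes valid: "valid_data D" and inv: "invertible_mat (pick_matrix D)"
begin

lemma pick_carrier: "pick_matrix D \<in> carrier_mat (num_nodes D) (num_nodes D)"
  by (simp add: pick_matrix_def)

lemmas pick_minv = minv_invertible[OF pick_carrier inv]

lemma pick_inv_sym:
  assumes "i < num_nodes D" "j < num_nodes D"
  shows "pick_inv D i j = pick_inv D j i"
proof -
  have "transpose_mat (pick_matrix D) = pick_matrix D"
    by (rule eq_matI) (auto simp: pick_matrix_def pick_entry_sym)
  from minv_symmetric[OF pick_carrier inv this]
  have "minv (pick_matrix D) $$ (i, j) = transpose_mat (minv (pick_matrix D)) $$ (i, j)" by simp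
  then show ?thesis using pick_minv(1) assms by (simp add: pick_inv_def)
qed

lemma pick_entry_pick_inv:
  assumes "i < num_nodes D" "j < num_nodes D"
  shows "(\<Sum>k<num_nodes D. pick_entry D i k * pick_inv D k j) = (if i = j then 1 else 0)"
proof -
  have "(pick_matrix D * minv (pick_matrix D)) $$ (i, j)
      = (\<Sum>k<num_nodes D. pick_entry D i k * pick_inv D k j)"
    using assms pick_minv(1) pick_carrier
    by (auto simp: scalar_prod_def pick_inv_def pick_matrix_def atLeast0LessThan)
  then show ?thesis using assms pick_minv(2) by simp
qed

lemma pick_inv_pick_entry:
  assumes "i < num_nodes D" "j < num_nodes D"
  shows "(\<Sum>k<num_nodes D. pick_inv D i k * pick_entry D k j) = (if i = j then 1 else 0)"
proof -
  have "(\<Sum>k<num_nodes D. pick_inv D i k * pick_entry D k j)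
      = (\<Sum>k<num_nodes D. pick_entry D j k * pick_inv D k i)"
    using assms by (intro sum.cong) (auto simp: pick_inv_sym[of i] pick_entry_sym[of D j])
  then show ?thesis using pick_entry_pick_inv[OF assms(2,1)] by auto
qed

lemma c_tilde_sum: "i < num_nodes D \<Longrightarrow> c_tilde D i = (\<Sum>k<num_nodes D. c_entry D k * pick_inv D k i)"
  using pick_minv(1)
  by (auto simp: c_tilde_def C_row_def c_entry_def pick_inv_def scalar_prod_def atLeast0LessThan
      intro!: sum.cong)

lemma e_tilde_sum: "i < num_nodes D \<Longrightarrow> e_tilde D i = (\<Sum>k<num_nodes D. e_entry D k * pick_inv D k i)"
  using pick_minv(1)
  by (auto simp: e_tilde_def E_row_def e_entry_def pick_inv_def scalar_prod_def atLeast0LessThan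
      intro!: sum.cong)

lemma p_tilde_eq: "p_tilde D i = pick_inv D i i"
  by (simp add: p_tilde_def pick_inv_def)

text \<open>Multiplying \<open>P X - X P = E^* C - C^* E\<close> by the inverse \<open>R\<close> of
  \<open>P\<close> on both sides gives \<open>X R - R X\<close> on the left and, by symmetry of
  \<open>R\<close>, products of entries of \<open>E R\<close> and \<open>C R\<close> on the
  right.\<close>

lemma pick_inv_lyapunov:
  assumes k: "k < num_nodes D" and i: "i < num_nodes D"
  shows "(node D k - node D i) * pick_inv D k i = e_tilde D k * c_tilde D i - c_tilde D k * e_tilde D i"
proof -
  let ?n = "num_nodes D" and ?R = "pick_inv D" and ?P = "pick_entry D" and ?x = "node D"
  have "(\<Sum>j<?n. \<Sum>l<?n. ?R k j * ((?x l - ?x j) * ?P j l) * ?R l i)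
      = (\<Sum>j<?n. \<Sum>l<?n. ?R k j * ?P j l * (?x l * ?R l i)) - (\<Sum>j<?n. \<Sum>l<?n. (?R k j * ?x j) * (?P j l * ?R l i))"
    by (simp add: sum_subtractf[symmetric] algebra_simps)
  also have "(\<Sum>j<?n. \<Sum>l<?n. ?R k j * ?P j l * (?x l * ?R l i))
      = (\<Sum>l<?n. (\<Sum>j<?n. ?R k j * ?P j l) * (?x l * ?R l i))"
    by (subst sum.swap) (simp add: sum_distrib_right)
  also have "\<dots> = (\<Sum>l<?n. if k = l then ?x l * ?R l i else 0)"
    using k by (intro sum.cong) (auto simp: pick_inv_pick_entry)
  also have "\<dots> = ?x k * ?R k i" using k by simp
  also have "(\<Sum>j<?n. \<Sum>l<?n. (?R k j * ?x j) * (?P j l * ?R l i)) = (\<Sum>j<?n. if i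
      = j then ?R k j * ?x j else 0)"
    using i by (intro sum.cong) (auto simp: pick_entry_pick_inv sum_distrib_left[symmetric])
  also have "\<dots> = ?R k i * ?x i" using i by simp
  finally have "(?x k - ?x i) * ?R k i = (\<Sum>j<?n. \<Sum>l<?n. ?R k j * ((?x l - ?x j) * ?P j l) * ?R l i)"
    by (simp add: algebra_simps)
  also have "\<dots> = (\<Sum>j<?n. \<Sum>l<?n. (e_entry D j * ?R j k) * (c_entry D l * ?R l i) - (c_entry D j * ?R j k) * (e_entry D l * ?R l i))"
  proof (intro sum.cong refl)
    fix j l assume "j \<in> {..<?n}" "l \<in> {..<?n}"
    then have "(?x l - ?x j) * ?P j l = e_entry D j * c_entry D l - c_entry D j * e_entry D l" "?R k j
        = ?R j k"
      using k by (auto intro: pick_lyapunov[OF valid] pick_inv_sym)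
    then show "?R k j * ((?x l - ?x j) * ?P j l) * ?R l i
        = (e_entry D j * ?R j k) * (c_entry D l * ?R l i) - (c_entry D j * ?R j k) * (e_entry D l * ?R l i)"
      by (simp only:) (simp add: algebra_simps)
  qed
  also have "\<dots> = e_tilde D k * c_tilde D i - c_tilde D k * e_tilde D i"
    using k i by (simp add: e_tilde_sum c_tilde_sum sum_subtractf sum_product)
  finally show ?thesis .
qed

text \<open>Multiplication by \<open>J_mat\<close> swaps the two columns, and its entries combine
  with the factor \<open>- \<i>\<close> to the signs +1 and -1. This is why \<open>e_tilde\<close>
  appears in the first column and \<open>- c_tilde\<close> in the second.\<close>

lemma Theta_entries:
  assumes z: "\<And>k. k < num_nodes D \<Longrightarrow> z \<noteq> complex_of_real (node D k)"
  shows "Theta D z $$ (0, 0) = 1 + resolvent_sum D (c_entry D) (e_tilde D) z"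
    "Theta D z $$ (0, 1) = - resolvent_sum D (c_entry D) (c_tilde D) z"
    "Theta D z $$ (1, 0) = resolvent_sum D (e_entry D) (e_tilde D) z"
    "Theta D z $$ (1, 1) = 1 - resolvent_sum D (e_entry D) (c_tilde D) z"
proof -
  let ?n = "num_nodes D"
  let ?G = "mat_diag ?n (\<lambda>k. 1 / (z - complex_of_real (node D k)))"
  let ?R = "map_mat complex_of_real (minv (pick_matrix D))"
  let ?M = "CE_mat D * ?G * ?R * transpose_mat (CE_mat D)"
  have "z \<cdot>\<^sub>m 1\<^sub>m ?n - X_mat D = mat_diag ?n (\<lambda>k. z - complex_of_real (node D k))"
    by (rule eq_matI) (auto simp: X_mat_def mat_diag_def)
  then have G: "minv (z \<cdot>\<^sub>m 1\<^sub>m ?n - X_mat D) = ?G"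
    using z by (simp add: minv_mat_diag)
  have CE: "CE_mat D \<in> carrier_mat 2 ?n"
    by (auto simp: CE_mat_def C_row_def E_row_def append_rows_def)
  have CE0: "CE_mat D $$ (0, k) = complex_of_real (c_entry D k)"
    and CE1: "CE_mat D $$ (Suc 0, k) = complex_of_real (e_entry D k)" if "k < ?n" for k
    using that by (auto simp: CE_mat_def C_row_def E_row_def append_rows_def c_entry_def e_entry_def)
  have R: "?R \<in> carrier_mat ?n ?n" using pick_minv(1) by simp
  have M: "?M \<in> carrier_mat 2 2" using CE R by (auto simp: mat_diag_def)
  have Mab: "?M $$ (a, b) = (\<Sum>k<?n. CE_mat D $$ (a, k) * (\<Sum>j<?n. CE_mat D $$ (b, j) * complex_of_real (pick_inv D j k)) / (z - complex_of_real (node D k)))"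
    if "a < 2" "b < 2" for a b
  proof -
    have "?M $$ (a, b) = (\<Sum>j<?n. (\<Sum>k<?n. CE_mat D $$ (a, k) * (1 / (z
        - complex_of_real (node D k))) * ?R $$ (k, j)) * CE_mat D $$ (b, j))"
      using that CE R mat_diag_mult_right[OF CE]
      by (simp add: scalar_prod_def atLeast0LessThan)
    also have "\<dots> = (\<Sum>j<?n. \<Sum>k<?n. CE_mat D $$ (a, k) * (1 / (z
        - complex_of_real (node D k))) * complex_of_real (pick_inv D j k) * CE_mat D $$ (b, j))"
      unfolding sum_distrib_right using R pick_minv(1)
      by (intro sum.cong refl) (simp add: pick_inv_def[symmetric] pick_inv_sym)
    also have "\<dots> = (\<Sum>k<?n. CE_mat D $$ (a, k) * (\<Sum>j<?n. CE_mat D $$ (b, j) * complex_of_real (pick_inv D j k)) / (z - complex_of_real (node D k)))"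
      by (subst sum.swap) (simp add: sum_distrib_left sum_divide_distrib mult_ac)
    finally show ?thesis .
  qed
  have M0: "?M $$ (a, 0) = (\<Sum>k<?n. CE_mat D $$ (a, k) * complex_of_real (c_tilde D k) / (z
      - complex_of_real (node D k)))"
    and M1: "?M $$ (a, Suc 0) = (\<Sum>k<?n. CE_mat D $$ (a, k) * complex_of_real (e_tilde D k) / (z
        - complex_of_real (node D k)))"
    if "a < 2" for a
    using that by (simp_all add: Mab CE0 CE1 c_tilde_sum e_tilde_sum)
  have J: "J_mat \<in> carrier_mat 2 2" "J_mat $$ (0, 0) = 0" "J_mat $$ (0, Suc 0) = - \<i>"
    "J_mat $$ (Suc 0, 0) = \<i>" "J_mat $$ (Suc 0, Suc 0) = 0"
    by (auto simp: J_mat_def mat_of_rows_list_def)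
  have MJ: "(?M * J_mat) $$ (a, b) = ?M $$ (a, 0) * J_mat $$ (0, b) + ?M $$ (a, Suc 0) * J_mat $$ (Suc 0, b)"
    if "a < 2" "b < 2" for a b
    using that by (rule mult_mat_2_index[OF M J(1)])
  have Th: "Theta D z $$ (a, b) = (if a = b then 1 else 0) - \<i> * (?M * J_mat) $$ (a, b)"
    if "a < 2" "b < 2" for a b
  proof -
    have "(1\<^sub>m 2 - \<i> \<cdot>\<^sub>m N) $$ (a, b) = (if a = b then 1 else 0) - \<i> * N $$ (a, b)"
      if "N \<in> carrier_mat 2 2" for N :: "complex mat"
      using that \<open>a < 2\<close> \<open>b < 2\<close> by auto
    from this[OF mult_carrier_mat[OF M J(1)]] show ?thesis
      unfolding Theta_def G .
  qed
  have i_mult_i: "\<i> * (s * \<i>) = - s" for s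
    by (simp add: complex_eq_iff)
  show "Theta D z $$ (0, 0) = 1 + resolvent_sum D (c_entry D) (e_tilde D) z"
    "Theta D z $$ (0, 1) = - resolvent_sum D (c_entry D) (c_tilde D) z"
    "Theta D z $$ (1, 0) = resolvent_sum D (e_entry D) (e_tilde D) z"
    "Theta D z $$ (1, 1) = 1 - resolvent_sum D (e_entry D) (c_tilde D) z"
    by (simp_all add: i_mult_i Th MJ M0 M1 J CE0 CE1 resolvent_sum_def del: index_mult_mat)
qed

end

section \<open>The transformation near a node with a pole datum\<close>

context
  fixes D :: interp_data and i :: nat
begin

abbreviation (input) "x_i \<equiv> complex_of_real (node D i)"
abbreviation (input) "col_i \<equiv> \<lambda>k. pick_inv D k i"

text \<open>In terms of the difference quotient \<open>q\<close> of the parameter at \<open>x\<^sub>i\<close>, the transformation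
  becomes one whose coefficients stay bounded and whose determinant stays away from \<open>0\<close> near \<open>x\<^sub>i\<close>.\<close>

definition coeff_a :: "complex \<Rightarrow> complex" where
  "coeff_a z = (z - x_i) + (z - x_i) * resolvent_sum D (c_entry D) (e_tilde D) z"
definition coeff_b :: "complex \<Rightarrow> complex" where
  "coeff_b z = (z - x_i) * resolvent_sum D (c_entry D) col_i z / e_tilde D i"
definition coeff_c :: "complex \<Rightarrow> complex" where
  "coeff_c z = resolvent_sum D (e_entry D) (e_tilde D) z"
definition coeff_d :: "complex \<Rightarrow> complex" where
  "coeff_d z = resolvent_sum D (e_entry D) col_i z / e_tilde D i"

context
  assumes valid: "valid_data D" and inv: "invertible_mat (pick_matrix D)"
    and i: "i \<in> {num_regular D..<num_nodes D}" and e_i: "e_tilde D i \<noteq> 0"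
begin

lemma i_less: "i < num_nodes D" and xi_nonzero: "xi D i \<noteq> 0"
  and c_entry_i: "c_entry D i = xi D i" and e_entry_i: "e_entry D i = 0"
  using i valid by (auto simp: valid_data_def c_entry_def e_entry_def)

lemma node_neq: "k < num_nodes D \<Longrightarrow> k \<noteq> i \<Longrightarrow> node D k \<noteq> node D i"
  using valid i_less by (auto simp: valid_data_def inj_on_def)

text \<open>The nodes are distinct, so only the term \<open>k = i\<close> has a pole at
  \<open>x_i\<close>.\<close>

lemma tendsto_residual_resolvent_sum:
  "((\<lambda>z. (z - x_i) * resolvent_sum D u v z) \<longlongrightarrow> complex_of_real (u i * v i)) (nontangentially (node D i))"
proof -
  let ?F = "nontangentially (node D i)"
  have "((\<lambda>z. (z - x_i) * (complex_of_real (u k * v k) / (z - complex_of_real (node D k))))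
      \<longlongrightarrow> (if k = i then complex_of_real (u i * v i) else 0)) ?F" if k: "k < num_nodes D" for k
  proof (cases "k = i")
    case True
    have "\<forall>\<^sub>F z in ?F. (z - x_i) * (complex_of_real (u k * v k) / (z - complex_of_real (node D k)))
        = complex_of_real (u i * v i)"
      using eventually_Im_pos_nontangentially by eventually_elim (use True in auto)
    then show ?thesis using True by (simp add: tendsto_eventually)
  next
    case False
    have "((\<lambda>z. (z - x_i) * (complex_of_real (u k * v k) / (z - complex_of_real (node D k))))
      \<longlongrightarrow> (x_i - x_i) * (complex_of_real (u k * v k) / (x_i - complex_of_real (node D k)))) ?F"
      using node_neq[OF k False] by (intro tendsto_intros tendsto_nontangentially_ident) auto
    then show ?thesis using False by simp
  qed
  then have "((\<lambda>z. \<Sum>k<num_nodes D. (z - x_i) * (complex_of_real (u k * v k) / (z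
      - complex_of_real (node D k))))
      \<longlongrightarrow> (\<Sum>k<num_nodes D. if k = i then complex_of_real (u i * v i) else 0)) ?F"
    by (intro tendsto_sum) auto
  then have "((\<lambda>z. (z - x_i) * resolvent_sum D u v z)
      \<longlongrightarrow> (\<Sum>k<num_nodes D. if k = i then complex_of_real (u i * v i) else 0)) ?F"
    by (simp only: resolvent_sum_def sum_distrib_left)
  then show ?thesis using i_less by simp
qed

text \<open>The assumption removes the only term with a pole. In the limit sum the term
  \<open>k = i\<close> is the quotient of 0 by 0, which has the value 0.\<close>

lemma tendsto_resolvent_sum:
  assumes "u i = 0"
  shows "(resolvent_sum D u v \<longlongrightarrow> complex_of_real (\<Sum>k<num_nodes D. u k * v k / (node D i - node D k)))
      (nontangentially (node D i))"
proof -
  have "((\<lambda>z. \<Sum>k<num_nodes D. complex_of_real (u k * v k) / (z - complex_of_real (node D k)))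
      \<longlongrightarrow> (\<Sum>k<num_nodes D. complex_of_real (u k * v k) / (x_i - complex_of_real (node D k))))
          (nontangentially (node D i))"
  proof (rule tendsto_sum)
    fix k assume k: "k \<in> {..<num_nodes D}"
    show "((\<lambda>z. complex_of_real (u k * v k) / (z - complex_of_real (node D k)))
      \<longlongrightarrow> complex_of_real (u k * v k) / (x_i - complex_of_real (node D k))) (nontangentially (node D i))"
    proof (cases "k = i")
      case True
      then show ?thesis using assms by simp
    next
      case False
      then have "node D i \<noteq> node D k" using node_neq[of k] k by auto
      then show ?thesis by (intro tendsto_intros tendsto_nontangentially_ident) auto
    qed
  qed
  then show ?thesis by (simp add: resolvent_sum_def[abs_def])
qed

text \<open>Row \<open>i\<close> of the Pick matrix is itself a resolvent evaluated at
  \<open>x_i\<close>: its entries at the regular nodes are \<open>\<xi>_i / (x_i - x_k)\<close>.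
  Equations for this row thereby give the limits of the second row of coefficients.\<close>

lemma pick_row_sum:
  "(\<Sum>k<num_nodes D. pick_entry D i k * y k)
    = xi D i * (\<Sum>k<num_nodes D. e_entry D k * y k / (node D i - node D k)) - xi D i * y i"
proof -
  have "(\<Sum>k<num_nodes D. pick_entry D i k * y k)
      = (\<Sum>k<num_nodes D. xi D i * (e_entry D k * y k / (node D i - node D k)) - (if k
          = i then xi D i * y i else 0))"
    using i by (intro sum.cong) (auto simp: pick_entry_def e_entry_def)
  then show ?thesis
    using i_less by (simp add: sum_subtractf sum_distrib_left)
qed

text \<open>\<open>e_tilde\<close> solves \<open>P y = E^*\<close>, and entry \<open>i\<close> of
  \<open>E\<close> is 0, so the two terms of \<open>pick_row_sum\<close> balance.\<close>

lemma sum_e_tilde: "(\<Sum>k<num_nodes D. e_entry D k * e_tilde D k / (node D i - node D k)) = e_tilde D i"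
proof -
  have "(\<Sum>k<num_nodes D. pick_entry D i k * e_tilde D k)
      = (\<Sum>k<num_nodes D. \<Sum>j<num_nodes D. pick_entry D i k * pick_inv D k j * e_entry D j)"
    by (intro sum.cong refl)
      (auto simp: e_tilde_sum[OF valid inv] sum_distrib_left pick_inv_sym[OF valid inv] mult_ac intro!: sum.cong)
  also have "\<dots> = (\<Sum>j<num_nodes D. (\<Sum>k<num_nodes D. pick_entry D i k * pick_inv D k j) * e_entry D j)"
    by (subst sum.swap) (simp add: sum_distrib_right)
  also have "\<dots> = (\<Sum>j<num_nodes D. if i = j then e_entry D j else 0)"
    using i_less by (intro sum.cong) (auto simp: pick_entry_pick_inv[OF valid inv])
  also have "\<dots> = 0" using i_less e_entry_i by simp
  finally show ?thesis
    using pick_row_sum[of "e_tilde D"] xi_nonzero by simp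
qed

text \<open>Here \<open>y\<close> is column \<open>i\<close> of the inverse, for which row
  \<open>i\<close> of \<open>P\<close> gives 1; this 1 is the source of the summand
  \<open>1 / \<xi>_i\<close>.\<close>

lemma sum_pick_inv_column:
  "(\<Sum>k<num_nodes D. e_entry D k * pick_inv D k i / (node D i - node D k)) = p_tilde D i + 1 / xi D i"
  using pick_row_sum[of col_i] pick_entry_pick_inv[OF valid inv i_less i_less] xi_nonzero
  by (simp add: p_tilde_eq[OF valid inv] field_simps)

text \<open>By \<open>pick_inv_lyapunov\<close> each term on the left carries the factor
  \<open>x_k - x_i\<close>. Splitting it as \<open>(z - x_i) - (z - x_k)\<close> yields the new
  resolvent sum and a constant free of denominators.\<close>

lemma resolvent_sum_pick_inv:
  assumes "0 < Im z" and v: "(\<Sum>k<num_nodes D. v k * pick_inv D k i) = vt"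
  shows "resolvent_sum D v (e_tilde D) z * c_tilde D i - resolvent_sum D v (c_tilde D) z * e_tilde D i
    = (z - x_i) * resolvent_sum D v col_i z - complex_of_real vt"
proof -
  have "complex_of_real (v k * e_tilde D k) / (z - complex_of_real (node D k)) * c_tilde D i
      - complex_of_real (v k * c_tilde D k) / (z - complex_of_real (node D k)) * e_tilde D i
    = (z - x_i) * (complex_of_real (v k * pick_inv D k i) / (z - complex_of_real (node D k)))
      - complex_of_real (v k * pick_inv D k i)" if k: "k < num_nodes D" for k
  proof -
    let ?zk = "z - complex_of_real (node D k)"
    have split_div: "(t - s) * c / s = t * (c / s) - c" if "s \<noteq> 0" for t s c :: complex
      using that by (simp add: field_simps)
    have zk: "?zk \<noteq> 0" using assms(1) by (auto simp: complex_eq_iff)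
    have "complex_of_real (v k * e_tilde D k) / ?zk * c_tilde D i
        - complex_of_real (v k * c_tilde D k) / ?zk * e_tilde D i
        = complex_of_real (v k * (e_tilde D k * c_tilde D i - c_tilde D k * e_tilde D i)) / ?zk"
      by (simp add: algebra_simps diff_divide_distrib)
    also have "\<dots> = complex_of_real (v k * ((node D k - node D i) * pick_inv D k i)) / ?zk"
      by (simp only: pick_inv_lyapunov[OF valid inv k i_less])
    also have "\<dots> = ((z - x_i) - ?zk) * complex_of_real (v k * pick_inv D k i) / ?zk"
      by (simp add: mult_ac)
    also have "\<dots> = (z - x_i) * (complex_of_real (v k * pick_inv D k i) / ?zk)
        - complex_of_real (v k * pick_inv D k i)"
      by (rule split_div[OF zk])
    finally show ?thesis .
  qed
  then show ?thesis
    unfolding resolvent_sum_def v[symmetric] sum_distrib_left sum_distrib_right of_real_sum sum_subtractf[symmetric]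
    by (intro sum.cong refl) auto
qed

text \<open>The determinant of the limits is \<open>\<xi> (p + 1/\<xi>) - \<xi> p = 1\<close>, so
  the limiting Moebius map is invertible.\<close>

lemma tendsto_coeffs:
  "(coeff_a \<longlongrightarrow> complex_of_real (xi D i * e_tilde D i)) (nontangentially (node D i))"
  "(coeff_b \<longlongrightarrow> complex_of_real (xi D i * p_tilde D i / e_tilde D i)) (nontangentially (node D i))"
  "(coeff_c \<longlongrightarrow> complex_of_real (e_tilde D i)) (nontangentially (node D i))"
  "(coeff_d \<longlongrightarrow> complex_of_real ((p_tilde D i + 1 / xi D i) / e_tilde D i)) (nontangentially (node D i))"
proof -
  let ?F = "nontangentially (node D i)"
  have "(coeff_a \<longlongrightarrow> (x_i - x_i) + complex_of_real (c_entry D i * e_tilde D i)) ?F"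
    unfolding coeff_a_def
    by (intro tendsto_intros tendsto_nontangentially_ident tendsto_residual_resolvent_sum)
  then show "(coeff_a \<longlongrightarrow> complex_of_real (xi D i * e_tilde D i)) ?F"
    by (simp add: c_entry_i)
  have "(coeff_b \<longlongrightarrow> complex_of_real (c_entry D i * pick_inv D i i) / complex_of_real (e_tilde D i)) ?F"
    unfolding coeff_b_def using e_i by (intro tendsto_divide tendsto_const tendsto_residual_resolvent_sum) auto
  then show "(coeff_b \<longlongrightarrow> complex_of_real (xi D i * p_tilde D i / e_tilde D i)) ?F"
    by (simp add: c_entry_i p_tilde_eq[OF valid inv])
  show "(coeff_c \<longlongrightarrow> complex_of_real (e_tilde D i)) ?F"
    using tendsto_resolvent_sum[of "e_entry D" "e_tilde D", OF e_entry_i]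
    unfolding coeff_c_def[abs_def] sum_e_tilde .
  have "(coeff_d \<longlongrightarrow> complex_of_real (p_tilde D i + 1 / xi D i) / complex_of_real (e_tilde D i)) ?F"
    unfolding coeff_d_def using e_i tendsto_resolvent_sum[of "e_entry D" col_i, OF e_entry_i]
    unfolding sum_pick_inv_column by (intro tendsto_divide tendsto_const) auto
  then show "(coeff_d \<longlongrightarrow> complex_of_real ((p_tilde D i + 1 / xi D i) / e_tilde D i)) ?F"
    by simp
qed

lemma Theta_entries_nontangentially:
  assumes "0 < Im z"
  shows "Theta D z $$ (0, 0) = 1 + resolvent_sum D (c_entry D) (e_tilde D) z"
    "Theta D z $$ (0, 1) = - resolvent_sum D (c_entry D) (c_tilde D) z"
    "Theta D z $$ (1, 0) = resolvent_sum D (e_entry D) (e_tilde D) z"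
    "Theta D z $$ (1, 1) = 1 - resolvent_sum D (e_entry D) (c_tilde D) z"
proof -
  have "z \<noteq> complex_of_real (node D k)" for k using assms by auto
  note Th = Theta_entries[OF valid inv this]
  show "Theta D z $$ (0, 0) = 1 + resolvent_sum D (c_entry D) (e_tilde D) z"
    "Theta D z $$ (0, 1) = - resolvent_sum D (c_entry D) (c_tilde D) z"
    "Theta D z $$ (1, 0) = resolvent_sum D (e_entry D) (e_tilde D) z"
    "Theta D z $$ (1, 1) = 1 - resolvent_sum D (e_entry D) (c_tilde D) z"
    by (rule Th)+
qed

text \<open>At the value \<open>\<eta>\<close> the identity part of \<open>Theta\<close> cancels the
  constant left by \<open>resolvent_sum_pick_inv\<close> in both rows. This leaves
  \<open>coeff_b\<close> in the first row and \<open>(z - x_i) coeff_d\<close> in the second; the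
  increment \<open>q (z - x_i)\<close> contributes the other two coefficients.\<close>

lemma escale_T_Theta_Fin:
  assumes z: "0 < Im z" and \<phi>: "\<phi> z = Fin u"
  defines "q \<equiv> (u - complex_of_real (eta D i)) / (z - x_i)"
  shows "escale (z - x_i) (T_Theta D \<phi> z) = ediv (coeff_a z * q + coeff_b z) (coeff_c z * q + coeff_d z)"
proof -
  let ?e = "complex_of_real (e_tilde D i)" and ?c = "complex_of_real (c_tilde D i)" and ?\<eta>
      = "complex_of_real (eta D i)"
  let ?t = "z - x_i"
  have t: "?t \<noteq> 0" using z by (auto simp: complex_eq_iff)
  have e: "?e \<noteq> 0" using e_i by simp
  have \<eta>: "?\<eta> * ?e = ?c" using e_i by (simp add: eta_def)
  have u: "u = ?\<eta> + q * ?t" using t by (simp add: q_def)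
  note Th = Theta_entries_nontangentially[OF z]
  have "(Theta D z $$ (0, 0) * ?\<eta> + Theta D z $$ (0, 1)) * ?e
      = ?c + (resolvent_sum D (c_entry D) (e_tilde D) z * ?c - resolvent_sum D (c_entry D) (c_tilde D) z * ?e)"
    unfolding Th \<eta>[symmetric] by (simp add: algebra_simps)
  also have "\<dots> = coeff_b z * ?e"
    using resolvent_sum_pick_inv[OF z c_tilde_sum[OF valid inv i_less, symmetric]] e
    by (simp add: coeff_b_def)
  finally have 0: "Theta D z $$ (0, 0) * ?\<eta> + Theta D z $$ (0, 1) = coeff_b z" using e by simp
  have "(Theta D z $$ (1, 0) * ?\<eta> + Theta D z $$ (1, 1)) * ?e
      = ?e + (resolvent_sum D (e_entry D) (e_tilde D) z * ?c - resolvent_sum D (e_entry D) (c_tilde D) z * ?e)"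
    unfolding Th \<eta>[symmetric] by (simp add: algebra_simps)
  also have "\<dots> = ?t * coeff_d z * ?e"
    using resolvent_sum_pick_inv[OF z e_tilde_sum[OF valid inv i_less, symmetric]] e
    by (simp add: coeff_d_def)
  finally have 1: "Theta D z $$ (1, 0) * ?\<eta> + Theta D z $$ (1, 1) = ?t * coeff_d z" using e by simp
  have num: "Theta D z $$ (0, 0) * u + Theta D z $$ (0, 1) = coeff_a z * q + coeff_b z"
    unfolding 0[symmetric] u Th(1) by (simp add: coeff_a_def algebra_simps)
  have "Theta D z $$ (1, 0) * u + Theta D z $$ (1, 1)
      = Theta D z $$ (1, 0) * q * ?t + (Theta D z $$ (1, 0) * ?\<eta> + Theta D z $$ (1, 1))"
    unfolding u by (simp add: algebra_simps)
  also have "\<dots> = Theta D z $$ (1, 0) * q * ?t + ?t * coeff_d z" by (simp only: 1)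
  also have "\<dots> = ?t * (coeff_c z * q + coeff_d z)"
    unfolding Th(3) by (simp add: coeff_c_def algebra_simps)
  finally have den: "Theta D z $$ (1, 0) * u + Theta D z $$ (1, 1) = ?t * (coeff_c z * q + coeff_d z)" .
  show ?thesis
    unfolding T_Theta_def \<phi> ecomplex.case num den using t by simp
qed

lemma escale_T_Theta_EInf:
  assumes z: "0 < Im z" and \<phi>: "\<phi> z = EInf"
  shows "escale (z - x_i) (T_Theta D \<phi> z) = ediv (coeff_a z) (coeff_c z)"
  unfolding T_Theta_def \<phi> ecomplex.case Theta_entries_nontangentially[OF z]
  by (simp add: coeff_a_def coeff_c_def algebra_simps)

lemma residual_limit_cong:
  assumes "\<And>z. 0 < Im z \<Longrightarrow> escale (z - x_i) (w z) = h z"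
  shows "residual_limit w (node D i) L \<longleftrightarrow> nt_limit h (node D i) L"
  unfolding residual_limit_def
  by (rule etendsto_cong, rule eventually_mono[OF eventually_Im_pos_nontangentially assms])

lemma residual_limit_T_Theta_EInf:
  assumes "\<And>z. 0 < Im z \<Longrightarrow> \<phi> z = EInf"
  shows "residual_limit (T_Theta D \<phi>) (node D i) (Fin (complex_of_real (xi D i)))"
proof -
  have "nt_limit (\<lambda>z. ediv (coeff_a z) (coeff_c z)) (node D i)
      (ediv (complex_of_real (xi D i * e_tilde D i)) (complex_of_real (e_tilde D i)))"
    using e_i by (intro etendsto_ediv tendsto_coeffs) auto
  then show ?thesis
    using residual_limit_cong[OF escale_T_Theta_EInf[OF _ assms]] e_i
    by (simp del: etendsto.simps)
qed

lemma residual_limit_T_Theta_at_infinity: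
  assumes \<phi>: "\<And>z. 0 < Im z \<Longrightarrow> \<phi> z = Fin (f z)"
    and q: "filterlim (\<lambda>z. (f z - complex_of_real (eta D i)) / (z - x_i))
        at_infinity (nontangentially (node D i))"
  shows "residual_limit (T_Theta D \<phi>) (node D i) (Fin (complex_of_real (xi D i)))"
proof -
  have "nt_limit (\<lambda>z. ediv (coeff_a z * ((f z - complex_of_real (eta D i)) / (z - x_i)) + coeff_b z)
        (coeff_c z * ((f z - complex_of_real (eta D i)) / (z - x_i)) + coeff_d z)) (node D i)
      (ediv (complex_of_real (xi D i * e_tilde D i)) (complex_of_real (e_tilde D i)))"
    using e_i by (intro etendsto_ediv_moebius[OF tendsto_coeffs q]) auto
  then show ?thesis
    using residual_limit_cong[OF escale_T_Theta_Fin[OF _ \<phi>]] e_i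
    by (simp del: etendsto.simps)
qed

lemma residual_limit_T_Theta_finite:
  fixes d :: real
  assumes \<phi>: "\<And>z. 0 < Im z \<Longrightarrow> \<phi> z = Fin (f z)"
    and q: "((\<lambda>z. (f z - complex_of_real (eta D i)) / (z - x_i))
        \<longlongrightarrow> complex_of_real d) (nontangentially (node D i))"
  defines "v \<equiv> (e_tilde D i)\<^sup>2 * d + p_tilde D i"
  shows "residual_limit (T_Theta D \<phi>) (node D i)
    (ediv (complex_of_real (xi D i * v / e_tilde D i)) (complex_of_real ((v + 1 / xi D i) / e_tilde D i)))"
proof -
  let ?a = "complex_of_real (xi D i * v / e_tilde D i)" and ?b
      = "complex_of_real ((v + 1 / xi D i) / e_tilde D i)"
  have a: "?a = complex_of_real (xi D i * e_tilde D i) * d + complex_of_real (xi D i * p_tilde D i / e_tilde D i)"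
    and b: "?b = complex_of_real (e_tilde D i) * d + complex_of_real ((p_tilde D i + 1 / xi D i) / e_tilde D i)"
    using e_i unfolding v_def of_real_mult[symmetric] of_real_add[symmetric] of_real_eq_iff
    by (simp_all add: power2_eq_square add_divide_distrib distrib_left)
  \<comment> \<open>Both could vanish only if \<open>v = 0\<close> and
    \<open>1 / \<xi> = 0\<close>.\<close>
  have "?a \<noteq> 0 \<or> ?b \<noteq> 0"
    using e_i xi_nonzero by auto
  then have "nt_limit (\<lambda>z. ediv (coeff_a z * ((f z - complex_of_real (eta D i)) / (z - x_i)) + coeff_b z)
        (coeff_c z * ((f z - complex_of_real (eta D i)) / (z - x_i)) + coeff_d z)) (node D i) (ediv ?a ?b)"
    unfolding a b by (intro etendsto_ediv tendsto_coeffs q tendsto_add tendsto_mult)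
  then show ?thesis
    using residual_limit_cong[OF escale_T_Theta_Fin[OF _ \<phi>]]
    by (simp del: etendsto.simps ediv.simps)
qed

end

end

section \<open>Classification of the residual limits\<close>

lemma ext_nevanlinna_cases:
  assumes "\<phi> \<in> ext_nevanlinna"
  obtains (finite) f where "f \<in> nevanlinna" "\<And>z. 0 < Im z \<Longrightarrow> \<phi> z = Fin (f z)"
  | (infinite) "\<And>z. 0 < Im z \<Longrightarrow> \<phi> z = EInf"
  using assms by (auto simp: ext_nevanlinna_def upper_half_plane_def)

lemma nt_limit_cong:
  assumes "\<And>z. 0 < Im z \<Longrightarrow> g z = h z"
  shows "nt_limit g x L \<longleftrightarrow> nt_limit h x L"
  by (rule etendsto_cong, rule eventually_mono[OF eventually_Im_pos_nontangentially assms])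

context
  fixes \<phi> :: "complex \<Rightarrow> ecomplex" and f :: "complex \<Rightarrow> complex"
  assumes f: "f \<in> nevanlinna" and \<phi>: "\<And>z. 0 < Im z \<Longrightarrow> \<phi> z = Fin (f z)"
begin

lemma value_eta_iff_tendsto:
  "value_eta D \<phi> i \<longleftrightarrow> (f \<longlongrightarrow> complex_of_real (eta D i)) (nontangentially (node D i))"
proof -
  have "nt_limit \<phi> x L \<longleftrightarrow> nt_limit (\<lambda>z. Fin (f z)) x L" for x L
    by (rule nt_limit_cong) (rule \<phi>)
  then show ?thesis
    by (simp only: value_eta_def etendsto_Fin_Fin_iff)
qed

lemma deriv_limit_iff_tendsto:
  "deriv_limit \<phi> x d \<longleftrightarrow> (deriv f \<longlongrightarrow> d) (nontangentially x)"
proof -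
  have "deriv (\<lambda>\<zeta>. fin_part (\<phi> \<zeta>)) z = deriv f z" if "0 < Im z" for z
  proof (rule deriv_cong_ev)
    have "\<forall>\<^sub>F \<zeta> in nhds z. \<zeta> \<in> {\<zeta>. 0 < Im \<zeta>}"
      using that open_halfspace_Im_gt[of 0] by (intro eventually_nhds_in_open) auto
    then show "\<forall>\<^sub>F \<zeta> in nhds z. fin_part (\<phi> \<zeta>) = f \<zeta>"
      by eventually_elim (simp add: \<phi>)
  qed simp
  then have "deriv_limit \<phi> x d \<longleftrightarrow> nt_limit (\<lambda>z. Fin (deriv f z)) x (Fin d)"
    unfolding deriv_limit_def by (intro nt_limit_cong) simp
  then show ?thesis by (simp only: etendsto_Fin_Fin_iff)
qed

lemma kernel_limit_iff_at_infinity: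
  "kernel_limit \<phi> x EInf \<longleftrightarrow> filterlim (\<lambda>z. nev_kernel f z z) at_infinity (nontangentially x)"
proof -
  have "kernel_limit \<phi> x EInf \<longleftrightarrow> nt_limit (\<lambda>z. Fin (nev_kernel f z z)) x EInf"
    unfolding kernel_limit_def by (intro nt_limit_cong) (simp add: nev_kernel_def \<phi>)
  then show ?thesis by (simp only: etendsto_Fin_EInf_iff)
qed

lemma f_holomorphic: "f holomorphic_on upper_half_plane"
  using f by (simp add: nevanlinna_def)

lemma conditions_quotient_at_infinity:
  assumes q: "filterlim (\<lambda>z. (f z - complex_of_real (eta D i)) / (z - complex_of_real (node D i)))
      at_infinity (nontangentially (node D i))"
  shows "cond_C1 D \<phi> i \<or> cond_C2 D \<phi> i" "\<not> (value_eta D \<phi> i \<and> deriv_limit \<phi> (node D i) d)"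
proof -
  show "cond_C1 D \<phi> i \<or> cond_C2 D \<phi> i"
  proof (cases "value_eta D \<phi> i")
    case True
    then have "kernel_limit \<phi> (node D i) EInf"
      using nev_kernel_at_infinity_of_quotient[OF f _ q]
      by (simp add: kernel_limit_iff_at_infinity value_eta_iff_tendsto)
    with True show ?thesis by (simp add: cond_C2_def)
  next
    case False
    \<comment> \<open>Pure logic: when \<open>\<eta>\<close> is not the limit, either there is no
      limit or there is a different one.\<close>
    then have "cond_C1 D \<phi> i"
      unfolding cond_C1_def value_eta_def by metis
    then show ?thesis ..
  qed
  show "\<not> (value_eta D \<phi> i \<and> deriv_limit \<phi> (node D i) d)"
    using quotient_not_at_infinity_of_deriv[OF f_holomorphic] q
    by (auto simp: value_eta_iff_tendsto deriv_limit_iff_tendsto)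
qed

text \<open>A finite limit of \<open>q\<close> determines value, derivative and kernel together;
  uniqueness of limits then excludes C1, and the finite kernel limit excludes C2.\<close>

lemma conditions_quotient_finite:
  fixes d :: real
  assumes q: "((\<lambda>z. (f z - complex_of_real (eta D i)) / (z - complex_of_real (node D i)))
      \<longlongrightarrow> complex_of_real d) (nontangentially (node D i))"
  shows "\<not> cond_C1 D \<phi> i" "\<not> cond_C2 D \<phi> i" "value_eta D \<phi> i"
    "deriv_limit \<phi> (node D i) d' \<longleftrightarrow> d' = complex_of_real d"
proof -
  show v: "value_eta D \<phi> i"
    using tendsto_of_quotient[OF q] by (simp add: value_eta_iff_tendsto)
  then show "\<not> cond_C1 D \<phi> i"
    unfolding cond_C1_def value_eta_def using etendsto_unique[OF nontangentially_neq_bot] by blast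
  have "\<not> filterlim (\<lambda>z. nev_kernel f z z) at_infinity (nontangentially (node D i))"
    using nev_kernel_tendsto_of_quotient[OF q] not_tendsto_and_filterlim_at_infinity[OF nontangentially_neq_bot]
    by blast
  then show "\<not> cond_C2 D \<phi> i"
    by (simp add: cond_C2_def kernel_limit_iff_at_infinity)
  show "deriv_limit \<phi> (node D i) d' \<longleftrightarrow> d' = complex_of_real d"
    using deriv_tendsto_of_quotient[OF f_holomorphic q] tendsto_unique[OF nontangentially_neq_bot]
    by (auto simp: deriv_limit_iff_tendsto)
qed

end

lemma residual_limit_unique:
  "residual_limit w x L \<Longrightarrow> residual_limit w x M \<Longrightarrow> L = M"
  unfolding residual_limit_def by (rule etendsto_unique[OF nontangentially_neq_bot])

text \<open>Everything is read off from \<open>1/L = 1/\<xi> + 1/(\<xi>^2 v)\<close>: the second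
  summand has the sign of \<open>v\<close>, is never 0, and becomes infinite exactly for
  \<open>v = 0\<close>.\<close>

lemma residual_trichotomy:
  fixes \<xi> e v :: real
  assumes \<xi>: "\<xi> \<noteq> 0" and e: "e \<noteq> 0"
  defines "L \<equiv> ediv (complex_of_real (\<xi> * v / e)) (complex_of_real ((v + 1 / \<xi>) / e))"
  shows "L \<noteq> Fin (complex_of_real \<xi>)"
    "(\<exists>t. einverse L = Fin (complex_of_real t) \<and> - t < - (1 / \<xi>)) \<longleftrightarrow> 0 < v"
    "(\<exists>t. einverse L = Fin (complex_of_real t) \<and> - (1 / \<xi>) < - t) \<longleftrightarrow> v < 0"
    "L = Fin 0 \<longleftrightarrow> v = 0"
proof -
  have inv: "einverse L = (if v = 0 then EInf else Fin (complex_of_real (1 / \<xi> + 1 / (\<xi>\<^sup>2 * v))))"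
  proof (cases "v + 1 / \<xi> = 0")
    \<comment> \<open>The pole of \<open>L\<close>: here \<open>1/L = 0\<close>, and the formula
      also gives 0.\<close>
    case True
    then have "v = - (1 / \<xi>)" by linarith
    then show ?thesis using \<xi> by (simp add: L_def power2_eq_square)
  next
    case False
    have "L = Fin (complex_of_real (\<xi> * v / (v + 1 / \<xi>)))"
      using e False unfolding L_def
      by (simp only: ediv.simps of_real_divide[symmetric] of_real_eq_0_iff) simp
    moreover have "einverse (Fin (complex_of_real r)) = (if r
        = 0 then EInf else Fin (complex_of_real (1 / r)))" for r
      by simp
    moreover have "\<xi> * v / (v + 1 / \<xi>) = 0 \<longleftrightarrow> v = 0"
      using \<xi> False by simp
    moreover have "1 / (\<xi> * v / (v + 1 / \<xi>)) = 1 / \<xi> + 1 / (\<xi>\<^sup>2 * v)" if "v \<noteq> 0"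
    proof -
      have "1 / (\<xi> * v / (v + 1 / \<xi>)) = (v + 1 / \<xi>) / (\<xi> * v)" by simp
      also have "\<dots> = 1 / \<xi> + 1 / (\<xi>\<^sup>2 * v)"
        using \<xi> that by (simp add: field_simps power2_eq_square)
      finally show ?thesis .
    qed
    ultimately show ?thesis by (cases "v = 0") (simp_all only: if_True if_False simp_thms)
  qed
  have sgn: "0 < \<xi>\<^sup>2" using \<xi> by simp
  show "(\<exists>t. einverse L = Fin (complex_of_real t) \<and> - t < - (1 / \<xi>)) \<longleftrightarrow> 0 < v"
    "(\<exists>t. einverse L = Fin (complex_of_real t) \<and> - (1 / \<xi>) < - t) \<longleftrightarrow> v < 0"
    unfolding inv using sgn by (auto simp: zero_less_mult_iff divide_less_0_iff mult_less_0_iff simp del: of_real_add of_real_divide)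
  show "L = Fin 0 \<longleftrightarrow> v = 0"
    using \<xi> e by (auto simp: L_def)
  show "L \<noteq> Fin (complex_of_real \<xi>)"
  proof
    assume "L = Fin (complex_of_real \<xi>)"
    then have "einverse L = Fin (complex_of_real (1 / \<xi>))" using \<xi> by simp
    then have "1 / (\<xi>\<^sup>2 * v) = 0 \<and> v \<noteq> 0"
      unfolding inv by (auto split: if_splits simp del: of_real_add of_real_divide)
    then show False using \<xi> by simp
  qed
qed

theorem theorem2p7:
  fixes D :: interp_data
    and \<phi> w :: "complex \<Rightarrow> ecomplex"
    and i :: nat
  assumes "valid_data D"
    and "invertible_mat (pick_matrix D)"
    and "\<phi> \<in> ext_nevanlinna"
    and "w = T_Theta D \<phi>"
    and "i \<in> {num_regular D..<num_nodes D}"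
    and "e_tilde D i \<noteq> 0"
  shows
    "(residual_limit w (node D i) (Fin (complex_of_real (xi D i)))
        \<longleftrightarrow> cond_C1 D \<phi> i \<or> cond_C2 D \<phi> i) \<and>
     ((\<exists>L. residual_limit w (node D i) L \<and>
         (\<exists>t::real. einverse L = Fin (complex_of_real t) \<and> - t < - (1 / xi D i)))
        \<longleftrightarrow> cond_C3 D \<phi> i) \<and>
     ((\<exists>L. residual_limit w (node D i) L \<and>
         (\<exists>t::real. einverse L = Fin (complex_of_real t) \<and> - (1 / xi D i) < - t))
        \<longleftrightarrow> cond_C4 D \<phi> i) \<and>
     (residual_limit w (node D i) (Fin 0)
        \<longleftrightarrow> cond_C5 D \<phi> i \<or> cond_C6 D \<phi> i)"
proof -
  note ctx = assms(1,2,5,6)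
  let ?x = "node D i" and ?\<xi> = "xi D i"
  have \<xi>: "?\<xi> \<noteq> 0" by (rule xi_nonzero[OF ctx])
  have lim: "residual_limit w ?x L \<longleftrightarrow> L = M" if "residual_limit w ?x M" for L M
    using that residual_limit_unique by blast
  \<comment> \<open>Shared by the parameter identically infinite and by an infinite limit of
    \<open>q\<close>. The residual limit is \<open>\<xi>\<close> in both cases, so the strict
    inequalities of the second and third claims fail, as does the value 0 of the fourth.\<close>
  have concl: ?thesis
    if M: "residual_limit w ?x (Fin (complex_of_real ?\<xi>))"
      and C12: "cond_C1 D \<phi> i \<or> cond_C2 D \<phi> i"
      and no: "\<And>d. \<not> (value_eta D \<phi> i \<and> deriv_limit \<phi> ?x d)"
  proof -
    have "\<not> cond_C3 D \<phi> i" "\<not> cond_C4 D \<phi> i" "\<not> cond_C5 D \<phi> i" "\<not> cond_C6 D \<phi> i"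
      using no by (auto simp: cond_C3_def cond_C4_def cond_C5_def cond_C6_def)
    moreover have "einverse (Fin (complex_of_real ?\<xi>)) = Fin (complex_of_real (1 / ?\<xi>))"
      using \<xi> by simp
    ultimately show ?thesis
      using C12 \<xi> unfolding lim[OF M] by (auto simp del: of_real_divide einverse.simps)
  qed
  show ?thesis
    using assms(3)
  proof (cases rule: ext_nevanlinna_cases)
    case infinite
    have "nt_limit \<phi> ?x EInf \<longleftrightarrow> nt_limit (\<lambda>_. EInf) ?x EInf"
      by (rule nt_limit_cong) (rule infinite)
    then have "nt_limit \<phi> ?x EInf" by simp
    moreover from this have "\<not> value_eta D \<phi> i"
      unfolding value_eta_def using etendsto_unique[OF nontangentially_neq_bot] by blast
    ultimately show ?thesis
      using residual_limit_T_Theta_EInf[OF ctx infinite]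
      by (intro concl) (auto simp: assms(4) cond_C1_def simp del: etendsto.simps)
  next
    case (finite f)
    let ?q = "\<lambda>z. (f z - complex_of_real (eta D i)) / (z - complex_of_real ?x)"
    consider d where "0 \<le> d" "(?q \<longlongrightarrow> complex_of_real d) (nontangentially ?x)"
      | "filterlim ?q at_infinity (nontangentially ?x)"
      using nevanlinna_quotient_limit[OF finite(1)] by blast
    then show ?thesis
    proof cases
      case 2
      show ?thesis
        using conditions_quotient_at_infinity[OF finite 2] residual_limit_T_Theta_at_infinity[OF ctx finite(2) 2]
        by (intro concl) (auto simp: assms(4))
    next
      case (1 d)
      define v where "v = (e_tilde D i)\<^sup>2 * d + p_tilde D i"
      define M where "M = ediv (complex_of_real (?\<xi> * v / e_tilde D i)) (complex_of_real ((v + 1 / ?\<xi>) / e_tilde D i))"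
      have M: "residual_limit w ?x M"
        unfolding M_def v_def assms(4) by (rule residual_limit_T_Theta_finite[OF ctx finite(2) 1(2)])
      have C: "\<not> cond_C1 D \<phi> i" "\<not> cond_C2 D \<phi> i" "value_eta D \<phi> i"
        "deriv_limit \<phi> ?x d' \<longleftrightarrow> d' = complex_of_real d" for d'
        using conditions_quotient_finite[OF finite(1) _ 1(2)] finite(2) by blast+
      note T = residual_trichotomy[OF \<xi> assms(6), of v, folded M_def]
      have e2: "0 < (e_tilde D i)\<^sup>2" using assms(6) by simp
      have "- p_tilde D i / (e_tilde D i)\<^sup>2 < d \<longleftrightarrow> 0 < v"
        "d < - p_tilde D i / (e_tilde D i)\<^sup>2 \<longleftrightarrow> v < 0"
        "d = - p_tilde D i / (e_tilde D i)\<^sup>2 \<longleftrightarrow> v = 0"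
        using e2 by (auto simp: v_def field_simps)
      note v = this
      \<comment> \<open>The lower bound \<open>0 \<le> d\<close> in C4 is the sign of the limit of
        \<open>q\<close>.\<close>
      have "cond_C3 D \<phi> i \<longleftrightarrow> 0 < v" "cond_C4 D \<phi> i \<longleftrightarrow> v < 0"
        using C(3) 1(1) v by (simp_all add: cond_C3_def cond_C4_def C(4))
      moreover have "cond_C5 D \<phi> i \<longleftrightarrow> v = 0 \<and> 0 < d" "cond_C6 D \<phi> i \<longleftrightarrow> d = 0 \<and> p_tilde D i = 0"
        using C(3) v(3) by (auto simp: cond_C5_def cond_C6_def C(4) simp del: of_real_divide)
      \<comment> \<open>The case \<open>v = 0\<close> splits by the sign of \<open>d\<close>:
        \<open>d > 0\<close> is C5, and for \<open>d = 0\<close> the number \<open>v\<close> is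
        \<open>p_tilde D i\<close>, which gives C6.\<close>
      then have "cond_C5 D \<phi> i \<or> cond_C6 D \<phi> i \<longleftrightarrow> v = 0"
        using 1(1) by (cases "d = 0") (auto simp: v_def)
      ultimately show ?thesis
        using C(1,2) T unfolding lim[OF M] by auto
    qed
  qed
qed

end
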